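(* Every graph $G$ in ${\cal H}_4$ (that is, every finite simple graph $G$ that has girth $8$ and has no even hole of length at least $10$) has a degree-$2$ vertex, or a $K_1$-cut, or a $K_2$-cut.
   Context: All graphs are finite, simple and undirected. The girth of a graph is the minimum length of a cycle in it. A hole in a graph is an induced cycle of length at least $4$; it is even if its length is even. For an integer $\ell\ge 2$, ${\cal H}_\ell$ denotes the family of graphs that have girth (exactly) $2\ell$ and have no even hole of length at least $2\ell+2$. A degree-$2$ vertex is a vertex with exactly two neighbors. For $k\in\{1,2\}$, a $K_k$-cut of $G$ is a set $X\subseteq V(G)$ of $k$ vertices that induces a complete graph $K_k$ (so a single vertex if $k=1$, the two ends of an edge if $k=2$) such that $G-X$ is disconnected. *)

theory Defs
  imports "Graph_Theory.Graph_Theory" "HOL-Library.Extended_Nat"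
begin

text \<open>
  A finite simple undirected graph is a \<^locale>\<open>pair_graph\<close>: a finite, loop-free, symmetric digraph
  whose arcs are pairs of vertices, so that an undirected edge \<open>{u,v}\<close> is the pair of arcs
  \<open>(u,v)\<close> and \<open>(v,u)\<close>.
\<close>

text \<open>
  The library's \<^const>\<open>pre_digraph.cycle\<close> admits the closed walk \<open>u, v, u\<close> along a single
  edge. Requiring length at least 3 leaves the undirected cycles, each represented by its arc
  list for every choice of a starting vertex and of an orientation.
\<close>

definition undir_cycle :: "'a pair_pre_digraph \<Rightarrow> ('a \<times> 'a) list \<Rightarrow> bool" where
  "undir_cycle G p \<longleftrightarrow> pre_digraph.cycle (with_proj G) p \<and> length p \<ge> 3"

text \<open>The girth of an acyclic graph is \<open>\<infinity>\<close>, the infimum of the empty set.\<close>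

definition girth :: "'a pair_pre_digraph \<Rightarrow> enat" where
  "girth G = (INF p \<in> {p. undir_cycle G p}. enat (length p))"

text \<open>
  \<open>fst ` set p\<close> is the vertex set of the cycle \<open>p\<close>; the cycle is induced if the subgraph induced
  by its vertices has no edges but those of \<open>p\<close>, each taken in both orientations.
\<close>

definition induced_cycle :: "'a pair_pre_digraph \<Rightarrow> ('a \<times> 'a) list \<Rightarrow> bool" where
  "induced_cycle G p \<longleftrightarrow>
     undir_cycle G p \<and> arcs (with_proj G \<restriction> (fst ` set p)) = set p \<union> (set p)\<inverse>"

definition hole :: "'a pair_pre_digraph \<Rightarrow> ('a \<times> 'a) list \<Rightarrow> bool" where
  "hole G p \<longleftrightarrow> induced_cycle G p \<and> length p \<ge> 4"

definition even_hole :: "'a pair_pre_digraph \<Rightarrow> ('a \<times> 'a) list \<Rightarrow> bool" where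
  "even_hole G p \<longleftrightarrow> hole G p \<and> even (length p)"

definition H_family :: "nat \<Rightarrow> 'a pair_pre_digraph set" where
  "H_family l = {G. pair_graph G \<and> girth G = enat (2 * l) \<and>
     \<not> (\<exists>p. even_hole G p \<and> length p \<ge> 2 * l + 2)}"

definition degree2_vertex :: "'a pair_pre_digraph \<Rightarrow> 'a \<Rightarrow> bool" where
  "degree2_vertex G v \<longleftrightarrow> v \<in> pverts G \<and> card {w. v \<rightarrow>\<^bsub>with_proj G\<^esub> w} = 2"

text \<open>
  \<^const>\<open>complete_digraph\<close> contains the condition \<open>card X = k\<close>. The name of
  \<^const>\<open>Digraph_Component.connected\<close> is qualified because of the topological
  \<^const>\<open>Topological_Spaces.connected\<close>.
\<close>

definition clique_cut :: "nat \<Rightarrow> 'a pair_pre_digraph \<Rightarrow> 'a set \<Rightarrow> bool" where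
  "clique_cut k G X \<longleftrightarrow> X \<subseteq> pverts G \<and>
     complete_digraph k (with_proj G \<restriction> X) \<and>
     \<not> Digraph_Component.connected (with_proj G \<restriction> (pverts G - X))"

end

theory Submission
  imports Defs
begin

text \<open>
  Let \<open>G\<close> have girth 8 and no even hole of length at least 10, and suppose that there is neither a
  vertex of degree 2 nor a clique cut with one or two vertices. Then every vertex has at least three neighbours,
  and deleting the ends of an edge leaves \<open>G\<close> connected. The girth supplies an induced 8-cycle, and
  the proof shows that it cannot exist.

  Fix an induced subgraph of \<open>G\<close>, the base. It is either an octagon, or a theta graph, which
  consists of two hubs and three paths of length 4 between them. Both are bipartite and have diameter 4, so by
  the girth a vertex outside has at most one neighbour in the base, its label, and two adjacent vertices outside
  are not both labelled. An ear is an induced path outside the base whose ends are labelled. A path of the base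
  between the end labels, if it avoids the labels inside the ear, closes the ear to a hole. An even hole has
  length 8, so if this length can be ruled out, the hole is odd. As the base is bipartite, this fixes the parity
  of the ear in terms of its end labels; it is called the odd type. Two configurations of ears of odd type are
  impossible.

  \<^item> Two ears with no edges between them that are linked by two paths of the base with no edges
    between them: all four paths form a hole, which is even and has length at least 10 (\<open>two_ears\<close>).
  \<^item> A tripod, that is, three induced legs that meet at a centre, with labelled vertices on the legs that give
    three ears of odd type: the three lengths have the wrong sum modulo 2 (\<open>tripod_refuted_sound\<close>).

  New ears are found by exploring. A base vertex with two neighbours in the base has a neighbour outside. Walk
  from there outside the base. The walk cannot be trapped between the base vertex and one of its neighbours,
  since they do not form a cut. So it either produces an ear of one of finitely many types, which has no edges
  to the ears found before (\<open>explore\<close>), or it touches one of these ears and creates a tripod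
  (\<open>touch_sound\<close>). This makes the search for a contradiction a finite game on the base: choose
  where to explore, and answer every possible outcome. The function \<open>refuted\<close> decides whether the
  game is won within a given number of rounds, and \<open>refuted_sound\<close> connects it with graphs.

  The game needs to know that ears with no labels inside, called clean, have odd type if their end labels are
  distinct and not adjacent. Such an ear is closed by two base paths of different lengths, which cannot both
  give a hole of length 8. The exceptions are the hubs of a theta graph, for which the game can do without this,
  and antipodal vertices of an octagon. There, a clean ear of the wrong parity completes the octagon to a theta
  graph. So the game is played first on the theta graph (\<open>no_theta\<close>) and then on the octagon
  (\<open>no_octagon\<close>).
\<close>

section \<open>Induced paths\<close>

text \<open>
  For a symmetric relation these are the induced paths, as vertex lists; it suffices to inspect the neighbours
  that come later in the list.
\<close>

fun ipath :: "('v \<Rightarrow> 'v \<Rightarrow> bool) \<Rightarrow> 'v list \<Rightarrow> bool" where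
  "ipath E [] \<longleftrightarrow> True"
| "ipath E (x # xs) \<longleftrightarrow> ipath E xs \<and> x \<notin> set xs \<and> (\<forall>y\<in>set xs. E x y \<longleftrightarrow> y = hd xs)"

lemma ipath_append:
  assumes "xs \<noteq> []" "ys \<noteq> []"
  shows "ipath E (xs @ ys) \<longleftrightarrow> ipath E xs \<and> ipath E ys \<and> set xs \<inter> set ys = {} \<and>
    (\<forall>x\<in>set xs. \<forall>y\<in>set ys. E x y \<longleftrightarrow> x = last xs \<and> y = hd ys)"
  using assms(1)
proof (induction xs)
  case (Cons x xs)
  show ?case
  proof (cases "xs = []")
    case True
    then show ?thesis using assms(2) by auto
  next
    case False
    have l: "last xs \<in> set xs" "hd xs \<in> set xs" and h: "hd ys \<in> set ys" using False assms(2) by auto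
    have "ipath E ((x # xs) @ ys) \<longleftrightarrow> ipath E (xs @ ys) \<and> x \<notin> set xs \<union> set ys \<and>
        (\<forall>y\<in>set xs \<union> set ys. E x y \<longleftrightarrow> y = hd xs)"
      using False by simp
    moreover have "hd xs \<notin> set ys \<and> last xs \<in> set xs" if "set xs \<inter> set ys = {}"
      using that l by blast
    ultimately show ?thesis using Cons.IH[OF False] False l h by auto
  qed
qed simp

lemma ipath_appendD: "ipath E (xs @ ys) \<Longrightarrow> ipath E xs \<and> ipath E ys"
  by (cases "xs = []"; cases "ys = []") (auto simp: ipath_append)

lemma ipath_rev:
  assumes "\<And>x y. E x y \<Longrightarrow> E y x"
  shows "ipath E (rev xs) = ipath E xs"
proof (induction xs)
  case (Cons x xs)
  then show ?case
    using assms by (cases "xs = []") (auto simp: ipath_append last_rev)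
qed simp

lemma ipath_distinct: "ipath E xs \<Longrightarrow> distinct xs"
  by (induction xs) auto

lemma ipath_successively: "ipath E xs \<Longrightarrow> successively E xs"
proof (induction xs)
  case (Cons x xs)
  then show ?case by (cases xs) auto
qed simp

lemma ipath_map:
  assumes "inj b" "\<And>i j. E (b i) (b j) \<longleftrightarrow> F i j"
  shows "ipath E (map b K) = ipath F K"
proof (induction K)
  case (Cons x xs)
  then show ?case using assms by (cases "xs = []") (auto simp: hd_map inj_eq)
qed simp

text \<open>
  The path is built from its start. Each new vertex z is appended after the first vertex that sees z.
\<close>

lemma ipath_of_walk:
  assumes "successively E p" "p \<noteq> []"
  shows "\<exists>q. q \<noteq> [] \<and> ipath E q \<and> hd q = hd p \<and> last q = last p \<and> set q \<subseteq> set p \<and> length q \<le> length p"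
  using assms
proof (induction p rule: rev_induct)
  case (snoc z p)
  show ?case
  proof (cases "p = []")
    case True
    then show ?thesis by (intro exI[of _ "[z]"]) auto
  next
    case False
    then have "successively E p" "E (last p) z"
      using snoc.prems by (auto simp: successively_append_iff)
    then obtain q where q: "q \<noteq> []" "ipath E q" "hd q = hd p" "last q = last p" "set q \<subseteq> set p"
        "length q \<le> length p"
      using snoc.IH False by blast
    show ?thesis
    proof (cases "z \<in> set q")
      case True
      then obtain q1 q2 where s: "q = q1 @ z # q2" by (auto dest: split_list)
      then have "ipath E (q1 @ [z])" using q(2) ipath_appendD[of E "q1 @ [z]" q2] by simp
      then show ?thesis using q s False
        by (intro exI[of _ "q1 @ [z]"]) (auto simp: hd_append)
    next
      case nz: False
      have "\<exists>v\<in>set q. E v z" using \<open>E (last p) z\<close> q(1,4) last_in_set by metis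
      then obtain q1 v q2 where s: "q = q1 @ v # q2" "E v z" "\<forall>u\<in>set q1. \<not> E u z"
        using split_list_first_prop[of q "\<lambda>v. E v z"] by blast
      have i: "ipath E (q1 @ [v])" using q(2) s(1) ipath_appendD[of E "q1 @ [v]" q2] by simp
      then have "v \<notin> set q1" using ipath_distinct by fastforce
      then have "ipath E ((q1 @ [v]) @ [z])"
        using i s nz by (subst ipath_append) auto
      then show ?thesis using q s False
        by (intro exI[of _ "q1 @ [v, z]"]) (auto simp: hd_append split: if_splits)
    qed
  qed
qed simp

definition reach :: "('v \<Rightarrow> 'v \<Rightarrow> bool) \<Rightarrow> 'v set \<Rightarrow> 'v \<Rightarrow> 'v \<Rightarrow> bool" where
  "reach E S = (\<lambda>x y. E x y \<and> x \<in> S \<and> y \<in> S)\<^sup>*\<^sup>*"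

lemma reach_ipath:
  assumes "reach E S x y" "x \<in> S"
  shows "\<exists>p. p \<noteq> [] \<and> ipath E p \<and> hd p = x \<and> last p = y \<and> set p \<subseteq> S"
proof -
  have "\<exists>p. p \<noteq> [] \<and> successively E p \<and> hd p = x \<and> last p = y \<and> set p \<subseteq> S"
    using assms unfolding reach_def
  proof (induction rule: rtranclp_induct)
    case base
    then show ?case by (intro exI[of _ "[x]"]) auto
  next
    case (step y z)
    then obtain p where "p \<noteq> []" "successively E p" "hd p = x" "last p = y" "set p \<subseteq> S" by blast
    then show ?case using step
      by (intro exI[of _ "p @ [z]"]) (auto simp: successively_append_iff)
  qed
  then obtain p where p: "p \<noteq> []" "successively E p" "hd p = x" "last p = y" "set p \<subseteq> S" by blast
  show ?thesis using ipath_of_walk[OF p(2,1)] p by (meson order_trans)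
qed

lemma reach_mem: "reach E S x y \<Longrightarrow> x \<in> S \<Longrightarrow> y \<in> S"
  unfolding reach_def by (induction rule: rtranclp_induct) auto

lemma reach_step: "reach E S x y \<Longrightarrow> E y z \<Longrightarrow> y \<in> S \<Longrightarrow> z \<in> S \<Longrightarrow> reach E S x z"
  unfolding reach_def by (rule rtranclp.rtrancl_into_rtrancl) auto

lemma walk_reach: "successively E p \<Longrightarrow> p \<noteq> [] \<Longrightarrow> set p \<subseteq> S \<Longrightarrow> reach E S (hd p) (last p)"
proof (induction p rule: rev_induct)
  case (snoc z p)
  show ?case
  proof (cases "p = []")
    case True
    then show ?thesis by (simp add: reach_def)
  next
    case False
    then have "reach E S (hd p) (last p)" "E (last p) z" "last p \<in> S" "z \<in> S"
      using snoc by (auto simp: successively_append_iff)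
    then show ?thesis using False reach_step by fastforce
  qed
qed simp

lemma reach_trans: "reach E S x y \<Longrightarrow> reach E S y z \<Longrightarrow> reach E S x z"
  unfolding reach_def by (rule rtranclp_trans)

lemma reach_sym:
  assumes "\<And>x y. E x y \<Longrightarrow> E y x" "reach E S x y" shows "reach E S y x"
  using assms(2) unfolding reach_def
proof (induction rule: rtranclp_induct)
  case (step y z)
  then have "E z y \<and> z \<in> S \<and> y \<in> S" using assms(1) by blast
  then show ?case using step.IH by (rule converse_rtranclp_into_rtranclp)
qed simp

section \<open>Girth 8 and even holes\<close>

text \<open>
  Every cycle is presented as a vertex z and a path p that starts and ends at neighbours of z. Thus a cycle has
  one vertex more than its p, and a long even hole is an odd p of length more than 7.
\<close>

locale girth8 =
  fixes V :: "'a set" and E :: "'a \<Rightarrow> 'a \<Rightarrow> bool"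
  assumes sym: "E x y \<Longrightarrow> E y x"
    and irr: "\<not> E x x"
    and EV: "E x y \<Longrightarrow> x \<in> V"
    and girth: "\<lbrakk>distinct (z # p); 2 \<le> length p; successively E (z # p); E (last p) z\<rbrakk> \<Longrightarrow> 7 \<le> length p"
    and even_hole: "\<lbrakk>ipath E p; 2 \<le> length p; z \<notin> set p;
       \<And>y. y \<in> set p \<Longrightarrow> E z y \<longleftrightarrow> y = hd p \<or> y = last p; odd (length p)\<rbrakk> \<Longrightarrow> length p \<le> 7"
begin

lemma E_comm: "E x y \<longleftrightarrow> E y x" using sym by blast

lemma ring_girth:
  assumes "xs \<noteq> []" "ys \<noteq> []" "distinct (xs @ ys)" "successively E xs" "successively E ys"
    "E (last xs) (hd ys)" "E (last ys) (hd xs)" "3 \<le> length xs + length ys"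
  shows "8 \<le> length xs + length ys"
proof -
  obtain z p where z: "xs = z # p" using assms(1) by (cases xs) auto
  have l: "last (p @ ys) = last ys" using assms(2) by simp
  have "7 \<le> length (p @ ys)"
  proof (rule girth[of z])
    show "distinct (z # p @ ys)" using assms(3) z by simp
    show "2 \<le> length (p @ ys)" using assms(8) z by simp
    show "E (last (p @ ys)) z" using assms(7) z l by simp
    have "successively E (xs @ ys)" using assms by (simp add: successively_append_iff)
    then show "successively E (z # p @ ys)" using z by simp
  qed
  then show ?thesis using z by simp
qed

text \<open>
  Two induced paths whose only mutual edges join the last vertex of each to the first vertex of the other form
  an induced cycle. If it is even it is a hole, so that its length can only be 8.
\<close>

lemma ring_even:
  assumes ne: "xs \<noteq> []" "ys \<noteq> []" and "ipath E xs" "ipath E ys" and d: "set xs \<inter> set ys = {}"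
    and c: "\<And>x y. x \<in> set xs \<Longrightarrow> y \<in> set ys \<Longrightarrow>
       E x y \<longleftrightarrow> (x = last xs \<and> y = hd ys) \<or> (x = hd xs \<and> y = last ys)"
    and l: "3 \<le> length xs + length ys" and e: "even (length xs + length ys)"
  shows "length xs + length ys = 8"
proof -
  \<comment> \<open>The hole is seen as the single vertex z together with the induced path formed by all other vertices.\<close>
  obtain z p where z: "xs = z # p" using ne by (cases xs) auto
  have ip: "ipath E (p @ ys)"
  proof (cases "p = []")
    case True then show ?thesis using assms by simp
  next
    case False
    then show ?thesis using assms z by (subst ipath_append) auto
  qed
  have i: "E z y \<longleftrightarrow> y = hd (p @ ys) \<or> y = last (p @ ys)" if y: "y \<in> set (p @ ys)" for y
  proof (cases "p = []")
    case True
    then show ?thesis using z c[of z y] y by auto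
  next
    case False
    have 1: "hd ys \<in> set ys" "last ys \<in> set ys" "hd p \<in> set p" "last p \<in> set p" using ne False by auto
    show ?thesis
    proof (cases "y \<in> set p")
      case True
      have "E z y \<longleftrightarrow> y = hd p" using assms(3) z True by simp
      then show ?thesis using False True 1 d z ne by auto
    next
      case nF: False
      then have yy: "y \<in> set ys" using y by simp
      have "z \<noteq> last xs" using assms(3) z False 1 by auto
      then have "E z y \<longleftrightarrow> y = last ys" using c[of z y] z yy by simp
      then show ?thesis using False yy 1 d z ne nF by auto
    qed
  qed
  have nz: "z \<notin> set (p @ ys)" using d z ipath_distinct[OF assms(3)] by auto
  have le: "2 \<le> length (p @ ys)" using l z by simp
  have "length (p @ ys) \<le> 7" using even_hole[OF ip le nz i] e z by simp
  moreover have "8 \<le> length xs + length ys"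
    using assms d by (intro ring_girth) (auto simp: ipath_distinct ipath_successively sym)
  ultimately show ?thesis using z by simp
qed

end

section \<open>Bases and ears\<close>

text \<open>
  In a base every two vertices are at distance at most 4, so the default value 4 is the true distance.
\<close>

definition capped_dist :: "('l \<Rightarrow> 'l list) \<Rightarrow> 'l \<Rightarrow> 'l \<Rightarrow> nat" where
  "capped_dist nb i j = (if i = j then 0 else if j \<in> set (nb i) then 1
     else if \<exists>x\<in>set (nb i). j \<in> set (nb x) then 2
     else if \<exists>x\<in>set (nb i). \<exists>y\<in>set (nb x). j \<in> set (nb y) then 3 else 4)"

definition among :: "('l \<times> 'l) list \<Rightarrow> 'l \<Rightarrow> 'l \<Rightarrow> bool" where
  "among X i j \<longleftrightarrow> (i, j) \<in> set X \<or> (j, i) \<in> set X"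

text \<open>
  A lower bound for the number of vertices of a clean ear, one without labels inside, from i to j. A geodesic of
  the base closes it to a cycle of length at least 8, which gives 7 minus the distance. If the parity of the ear
  is known, that cycle is odd and thus has length at least 9, which gains 1.
\<close>

definition length_bound :: "('l \<Rightarrow> 'l list) \<Rightarrow> ('l \<times> 'l) list \<Rightarrow> 'l \<Rightarrow> 'l \<Rightarrow> nat" where
  "length_bound nb X i j = (if among X i j then 3 else
     let d = capped_dist nb i j in
     if d = 0 then 7 else if d = 1 then 6 else if d = 2 then 6 else if d = 3 then 5 else 4)"

text \<open>
  Depth-first search from the vertices on a stack, avoiding those already seen. The first list is only fuel:
  when it runs out the search fails, so the amount does not matter for soundness.
\<close>

fun dfs :: "('l \<Rightarrow> 'l list) \<Rightarrow> 'k list \<Rightarrow> 'l list \<Rightarrow> 'l list \<Rightarrow> 'l \<Rightarrow> bool" where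
  "dfs nb [] seen st c = False"
| "dfs nb (f # fs) seen [] c = False"
| "dfs nb (f # fs) seen (x # st) c = (x = c \<or>
     (if x \<in> set seen then dfs nb fs seen st c else dfs nb fs (x # seen) (nb x @ st) c))"

definition linked :: "('l \<Rightarrow> 'l list) \<Rightarrow> 'l list \<Rightarrow> 'l \<Rightarrow> 'l \<Rightarrow> 'l list \<Rightarrow> bool" where
  "linked nb us a c J \<longleftrightarrow> a \<notin> set J \<and> c \<notin> set J \<and> dfs nb (us @ us @ us) J [a] c"

text \<open>
  A criterion for an ear from a to c, whose inside carries exactly the labels J, to have odd type. For J empty
  this is an assumption on clean ears. Otherwise a base path that avoids J closes the ear to a hole, and that
  hole must be longer than 8: the first label k and the last label l inside cut off two clean ears, which share
  at most one vertex and whose lengths are bounded below, and the closing path has at least two vertices, or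
  three if a and c are not adjacent.
\<close>

definition forced_odd :: "('l \<Rightarrow> 'l list) \<Rightarrow> 'l list \<Rightarrow> ('l \<times> 'l) list \<Rightarrow> 'l \<Rightarrow> 'l \<Rightarrow> 'l list \<Rightarrow> bool" where
  "forced_odd nb us X a c J \<longleftrightarrow> a \<noteq> c \<and>
     (if J = [] then c \<notin> set (nb a) \<and> \<not> among X a c
      else linked nb us a c J \<and>
        (\<forall>k\<in>set J. \<forall>l\<in>set J.
           9 < length_bound nb X a k + length_bound nb X l c + (if c \<in> set (nb a) then 2 else 3)))"

lemma dfs_sound:
  assumes "dfs nb fs seen st c" "c \<notin> J" "J \<subseteq> set seen" "a \<notin> J"
    "\<And>x. x \<in> set st \<Longrightarrow> x \<in> J \<or> reach (\<lambda>i j. j \<in> set (nb i)) (- J) a x"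
  shows "reach (\<lambda>i j. j \<in> set (nb i)) (- J) a c"
  using assms
proof (induction nb fs seen st c rule: dfs.induct)
  case (3 nb f fs seen x st c)
  show ?case
  proof (cases "x = c")
    case True
    then show ?thesis using 3 by auto
  next
    case xc: False
    show ?thesis
    proof (cases "x \<in> set seen")
      case True
      then show ?thesis using 3 xc by auto
    next
      case False
      then have "x \<notin> J" "reach (\<lambda>i j. j \<in> set (nb i)) (- J) a x" using "3.prems" by auto
      then have "y \<in> J \<or> reach (\<lambda>i j. j \<in> set (nb i)) (- J) a y" if "y \<in> set (nb x)" for y
        using that reach_step[of "\<lambda>i j. j \<in> set (nb i)" "- J" a x y] by auto
      then show ?thesis using 3 xc False by auto
    qed
  qed
qed auto

lemma linked_sound:
  assumes "linked nb us a c J"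
  shows "\<exists>K. K \<noteq> [] \<and> ipath (\<lambda>i j. j \<in> set (nb i)) K \<and> hd K = a \<and> last K = c \<and> set K \<inter> set J = {}"
proof -
  have "reach (\<lambda>i j. j \<in> set (nb i)) (- set J) a c"
    using assms unfolding linked_def by (intro dfs_sound[of nb _ J]) (auto simp: reach_def)
  from reach_ipath[OF this] show ?thesis using assms by (auto simp: linked_def)
qed

text \<open>
  The base is an induced subgraph given by its embedding b. Its vertices are named by labels, so that statements
  about the base can be decided by computation. It is bipartite, with colouring col.
\<close>

locale base_graph = girth8 V E for V :: "'a set" and E +
  fixes b :: "'l \<Rightarrow> 'a" and nb :: "'l \<Rightarrow> 'l list" and col :: "'l \<Rightarrow> bool"
  assumes inj: "inj b" and bV: "b i \<in> V" and bE: "E (b i) (b j) \<longleftrightarrow> j \<in> set (nb i)"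
    and col: "j \<in> set (nb i) \<Longrightarrow> col i \<noteq> col j"
    and diam: "capped_dist nb i j = 4 \<Longrightarrow> \<exists>x\<in>set (nb i). \<exists>y\<in>set (nb x). \<exists>z\<in>set (nb y). j \<in> set (nb z)"
begin

abbreviation adj where "adj \<equiv> \<lambda>i j. j \<in> set (nb i)"

lemma adj_sym: "adj i j \<longleftrightarrow> adj j i" using bE E_comm by metis
lemma adj_irr: "\<not> adj i i" using bE irr by metis

definition Out where "Out = V - range b"
definition labels where "labels xs = {k. \<exists>v\<in>set xs. E v (b k)}"

lemma labels_simps [simp]: "labels [] = {}" "labels (xs @ ys) = labels xs \<union> labels ys" "labels (rev xs) = labels xs"
  "labels (x # xs) = {k. E x (b k)} \<union> labels xs"
  by (auto simp: labels_def)

text \<open>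
  J is exactly the set of labels strictly inside, not merely a bound: labels that do occur there cut off clean
  ears at both ends, and these make the ear long.
\<close>

definition ear where
  "ear R i j J \<longleftrightarrow> ipath E R \<and> set R \<subseteq> Out \<and> 2 \<le> length R \<and>
     E (hd R) (b i) \<and> E (last R) (b j) \<and> labels (butlast (tl R)) = J"

lemma earI: "ipath E (u # M @ [v]) \<Longrightarrow> set (u # M @ [v]) \<subseteq> Out \<Longrightarrow> E u (b i) \<Longrightarrow> E v (b j) \<Longrightarrow> labels M = J
   \<Longrightarrow> ear (u # M @ [v]) i j J"
  by (auto simp: ear_def)

lemma earE:
  assumes "ear R i j J"
  obtains u M v where "R = u # M @ [v]" "ipath E R" "u \<in> Out" "v \<in> Out" "set M \<subseteq> Out" "E u (b i)" "E v (b j)" "labels M = J"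
proof -
  obtain u S where R: "R = u # S" "S \<noteq> []"
    using assms by (cases R; cases "tl R") (auto simp: ear_def)
  then obtain M v where "S = M @ [v]" by (metis append_butlast_last_id)
  then show ?thesis using assms R that[of u M v] by (auto simp: ear_def)
qed

lemma ear_rev: "ear R i j J \<Longrightarrow> ear (rev R) j i J"
proof -
  assume e: "ear R i j J"
  then obtain u M v where R: "R = u # M @ [v]" "ipath E R" "u \<in> Out" "v \<in> Out" "set M \<subseteq> Out"
    "E u (b i)" "E v (b j)" "labels M = J" by (rule earE)
  have "ipath E (rev R)" using R(2) ipath_rev[of E R] sym by blast
  then have "ear (v # rev M @ [u]) j i J" using R by (intro earI) auto
  then show ?thesis using R(1) by simp
qed

lemma capped_dist_le: "capped_dist nb i j \<le> 4" by (auto simp: capped_dist_def)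

lemma geodesic: "\<exists>K. K \<noteq> [] \<and> ipath adj K \<and> hd K = i \<and> last K = j \<and> length K \<le> capped_dist nb i j + 1"
proof -
  have "\<exists>K. K \<noteq> [] \<and> successively adj K \<and> hd K = i \<and> last K = j \<and> length K \<le> capped_dist nb i j + 1"
  proof -
    consider "capped_dist nb i j = 0" | "capped_dist nb i j = 1" | "capped_dist nb i j = 2" | "capped_dist nb i j = 3" | "capped_dist nb i j = 4"
      using capped_dist_le[of i j] by linarith
    then show ?thesis
    proof cases
      case 1 then show ?thesis by (intro exI[of _ "[i]"]) (auto simp: capped_dist_def split: if_splits)
    next
      case 2 then show ?thesis by (intro exI[of _ "[i,j]"]) (auto simp: capped_dist_def split: if_splits)
    next
      case 3
      then obtain x where "adj i x" "adj x j" by (auto simp: capped_dist_def split: if_splits)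
      then show ?thesis using 3 by (intro exI[of _ "[i,x,j]"]) auto
    next
      case 4
      then obtain x y where "adj i x" "adj x y" "adj y j" by (auto simp: capped_dist_def split: if_splits)
      then show ?thesis using 4 by (intro exI[of _ "[i,x,y,j]"]) auto
    next
      case 5
      then obtain x y z where "adj i x" "adj x y" "adj y z" "adj z j" using diam by blast
      then show ?thesis using 5 by (intro exI[of _ "[i,x,y,z,j]"]) auto
    qed
  qed
  then show ?thesis using ipath_of_walk by (metis (no_types, lifting) order_trans)
qed

lemma ipath_b: "ipath E (map b K) = ipath adj K"
  using ipath_map[of b E adj K] inj bE by blast

lemma closed_walk_girth:
  assumes "ipath E R" "set R \<subseteq> Out" "R \<noteq> []" "E (hd R) (b i)" "E (last R) (b j)"
    "ipath adj K" "K \<noteq> []" "hd K = j" "last K = i" "3 \<le> length R + length K"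
  shows "8 \<le> length R + length K"
proof -
  have "8 \<le> length R + length (map b K)"
    using assms ipath_b[of K] inj
    by (intro ring_girth)
      (auto simp: ipath_distinct ipath_successively hd_map last_map sym distinct_map Out_def inj_on_def)
  then show ?thesis by simp
qed

text \<open>
  Two base neighbours would be joined by a base path of length at most 4 and thus lie on a cycle of length at
  most 6.
\<close>

lemma one_label: "v \<in> Out \<Longrightarrow> E v (b i) \<Longrightarrow> E v (b j) \<Longrightarrow> i = j"
proof (rule ccontr)
  assume a: "v \<in> Out" "E v (b i)" "E v (b j)" "i \<noteq> j"
  obtain K where K: "K \<noteq> []" "ipath adj K" "hd K = j" "last K = i" "length K \<le> capped_dist nb j i + 1"
    using geodesic by blast
  have "2 \<le> length K" using K a(4) by (cases K; cases "tl K") auto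
  then have "8 \<le> length [v] + length K"
    using a K by (intro closed_walk_girth[of "[v]" i j]) auto
  then show False using K(5) capped_dist_le[of j i] by simp
qed

text \<open>
  The two labels are at distance at most 4, which would give a cycle of length at most 7.
\<close>

lemma adjacent_labels: "v \<in> Out \<Longrightarrow> w \<in> Out \<Longrightarrow> E v w \<Longrightarrow> E v (b i) \<Longrightarrow> E w (b j) \<Longrightarrow> False"
proof -
  assume a: "v \<in> Out" "w \<in> Out" "E v w" "E v (b i)" "E w (b j)"
  obtain K where K: "K \<noteq> []" "ipath adj K" "hd K = j" "last K = i" "length K \<le> capped_dist nb j i + 1"
    using geodesic by blast
  have "1 \<le> length K" using K by (cases K) auto
  then have "8 \<le> length [v, w] + length K"
    using a K irr by (intro closed_walk_girth[of "[v, w]" i j]) auto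
  then show False using K(5) capped_dist_le[of j i] by simp
qed

lemma label_set: "v \<in> Out \<Longrightarrow> E v (b i) \<Longrightarrow> {k. E v (b k)} = {i}"
  using one_label by blast

lemma ear_girth:
  assumes "ear R i j J" "ipath adj K" "K \<noteq> []" "hd K = j" "last K = i"
  shows "8 \<le> length R + length K"
proof (rule closed_walk_girth[of _ i j])
  show "3 \<le> length R + length K" using assms by (cases K) (auto simp: ear_def)
qed (use assms in \<open>auto simp: ear_def\<close>)

lemma ear_hole:
  assumes e: "ear R i j J" and K: "ipath adj K" "K \<noteq> []" "hd K = j" "last K = i" "set K \<inter> J = {}"
    and p: "even (length R + length K)"
  shows "length R + length K = 8"
proof -
  obtain u M v where R: "R = u # M @ [v]" "ipath E R" "u \<in> Out" "v \<in> Out" "set M \<subseteq> Out"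
    "E u (b i)" "E v (b j)" "labels M = J" using e by (rule earE)
  have "length R + length (map b K) = 8"
  proof (rule ring_even)
    show "ipath E (map b K)" using K ipath_b by simp
    show "set R \<inter> set (map b K) = {}" using R by (auto simp: Out_def)
    show "3 \<le> length R + length (map b K)" using R K by (cases K) auto
    fix x y assume x: "x \<in> set R" and y: "y \<in> set (map b K)"
    then obtain k where k: "k \<in> set K" "y = b k" by auto
    have y1: "y = hd (map b K) \<longleftrightarrow> k = j" "y = last (map b K) \<longleftrightarrow> k = i"
      using K k inj by (auto simp: hd_map last_map inj_eq)
    have "u \<noteq> v" "u \<notin> set M" "v \<notin> set M" using ipath_distinct[OF R(2)] R(1) by auto
    moreover have "\<not> E x y" if "x \<in> set M" using that R(8) k K(5) by (auto simp: labels_def)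
    moreover have "E u y \<longleftrightarrow> k = i" "E v y \<longleftrightarrow> k = j" using R k one_label by auto
    ultimately show "E x y \<longleftrightarrow> (x = last R \<and> y = hd (map b K)) \<or> (x = hd R \<and> y = last (map b K))"
      using x R(1) y1 by auto
  qed (use R K p in auto)
  then show ?thesis by simp
qed

lemma col_path: "successively adj K \<Longrightarrow> K \<noteq> [] \<Longrightarrow> even (length K) \<longleftrightarrow> col (hd K) \<noteq> col (last K)"
proof (induction K)
  case (Cons x K)
  then show ?case using col[of "hd K" x] by (cases K) auto
qed simp

text \<open>
  The parity for which closing the ear by a path of the base, which is bipartite, gives an odd cycle.
\<close>

definition odd_type where "odd_type R i j \<longleftrightarrow> (even (length R) \<longleftrightarrow> col i = col j)"

lemma odd_typeI:
  assumes "ear R i j J" "ipath adj K" "K \<noteq> []" "hd K = j" "last K = i" "set K \<inter> J = {}"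
    and "8 < length R + length K"
  shows "odd_type R i j"
proof -
  have "odd (length R + length K)" using ear_hole assms by fastforce
  then show ?thesis using col_path[OF ipath_successively[OF assms(2)] assms(3)] assms
    unfolding odd_type_def by auto
qed

end

text \<open>
  The pairs in X are those for which a clean ear of the other parity is conceivable, because it may close up
  with the base to holes that all have length 8.
\<close>

locale odd_base = base_graph V E b nb col for V :: "'a set" and E and b :: "'l \<Rightarrow> 'a" and nb col +
  fixes us :: "'l list" and X :: "('l \<times> 'l) list"
  assumes us: "set us = UNIV"
    and clean_odd: "ear R i j {} \<Longrightarrow> i \<noteq> j \<Longrightarrow> \<not> adj i j \<Longrightarrow> \<not> among X i j \<Longrightarrow> odd_type R i j"
begin

text \<open>
  The parity of the ear makes the closed cycle odd unless its ends are equal, adjacent or a pair of X.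
\<close>

lemma length_bound_sound:
  assumes e: "ear R i j {}" shows "length_bound nb X i j \<le> length R"
proof -
  obtain K where K: "K \<noteq> []" "ipath adj K" "hd K = j" "last K = i" "length K \<le> capped_dist nb j i + 1"
    using geodesic by blast
  obtain K' where K': "K' \<noteq> []" "ipath adj K'" "hd K' = i" "last K' = j" "length K' \<le> capped_dist nb i j + 1"
    using geodesic by blast
  have g: "8 \<le> length R + length K'" using ear_girth[OF ear_rev[OF e], of K'] K' by simp
  show ?thesis
  proof (cases "i = j \<or> adj i j \<or> among X i j")
    case True
    then show ?thesis using g K'(5) capped_dist_le[of i j] by (auto simp: length_bound_def capped_dist_def)
  next
    case False
    then have "odd_type R i j" using clean_odd e by auto
    then have "odd (length R + length K')"
      using col_path[OF ipath_successively[OF K'(2)] K'(1)] K' unfolding odd_type_def by auto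
    then have "9 \<le> length R + length K'" using g by presburger
    moreover have "capped_dist nb i j \<noteq> 0" "capped_dist nb i j \<noteq> 1" using False by (auto simp: capped_dist_def)
    ultimately show ?thesis using K'(5) capped_dist_le[of i j] False unfolding length_bound_def Let_def by auto
  qed
qed

lemma forced_odd_sound:
  assumes e: "ear R i j (set J)" and o: "forced_odd nb us X i j J"
  shows "odd_type R i j"
proof (cases "J = []")
  case True
  then show ?thesis using e o clean_odd by (auto simp: forced_odd_def)
next
  case False
  then have l: "linked nb us i j J" and ij: "i \<noteq> j"
    and lbs: "\<And>k l. k \<in> set J \<Longrightarrow> l \<in> set J \<Longrightarrow> 9 < length_bound nb X i k + length_bound nb X l j + (if adj i j then 2 else 3)"
    using o by (auto simp: forced_odd_def)
  obtain u M v where R: "R = u # M @ [v]" "ipath E R" "u \<in> Out" "v \<in> Out" "set M \<subseteq> Out"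
    "E u (b i)" "E v (b j)" "labels M = set J" using e by (rule earE)
  have m0: "\<exists>x\<in>set M. \<exists>k. E x (b k)"
  proof -
    obtain k where "k \<in> labels M" using R(8) False by (cases J) auto
    then show ?thesis by (auto simp: labels_def)
  qed
  obtain M1 y M2 where s1: "M = M1 @ y # M2" "\<exists>k. E y (b k)" "\<forall>x\<in>set M1. \<not> (\<exists>k. E x (b k))"
    using split_list_first_prop[OF m0] by blast
  obtain N1 z N2 where s2: "M = N1 @ z # N2" "\<exists>k. E z (b k)" "\<forall>x\<in>set N2. \<not> (\<exists>k. E x (b k))"
    using split_list_last_prop[OF m0] by blast
  obtain k l where kl: "E y (b k)" "E z (b l)" using s1 s2 by auto
  have "k \<in> labels M" using kl(1) s1(1) by simp
  moreover have "l \<in> labels M" using kl(2) s2(1) by simp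
  ultimately have kJ: "k \<in> set J" "l \<in> set J" using R(8) by auto
  have e1: "ear (u # M1 @ [y]) i k {}"
  proof (rule earI)
    show "ipath E (u # M1 @ [y])"
      using R(1,2) s1(1) ipath_appendD[of E "u # M1 @ [y]" "M2 @ [v]"] by simp
  qed (use R s1 kl in \<open>auto simp: labels_def\<close>)
  have e2: "ear (z # N2 @ [v]) l j {}"
  proof (rule earI)
    show "ipath E (z # N2 @ [v])"
      using R(1,2) s2(1) ipath_appendD[of E "u # N1" "z # N2 @ [v]"] by simp
  qed (use R s2 kl in \<open>auto simp: labels_def\<close>)
  have "length M1 \<le> length N1"
  proof (rule ccontr)
    assume "\<not> ?thesis"
    then have "M ! length N1 \<in> set M1" using s1(1) by (simp add: nth_append)
    then show False using s1(3) s2(1,2) by (simp add: nth_append)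
  qed
  then have len: "length_bound nb X i k + length_bound nb X l j \<le> length R + 1"
    using length_bound_sound[OF e1] length_bound_sound[OF e2] R(1) s2(1) by simp
  obtain K where K: "K \<noteq> []" "ipath adj K" "hd K = j" "last K = i" "set K \<inter> set J = {}"
    "(if adj i j then 2 else 3) \<le> length K"
  proof -
    obtain K where K: "K \<noteq> []" "ipath adj K" "hd K = i" "last K = j" "set K \<inter> set J = {}"
      using linked_sound[OF l] by blast
    have "(if adj i j then 2 else 3) \<le> length K"
      using K ij by (cases K; cases "tl K"; cases "tl (tl K)") auto
    moreover have "ipath adj (rev K)" using ipath_rev[of adj K] adj_sym K by blast
    ultimately show ?thesis using K that[of "rev K"] by (auto simp: hd_rev last_rev)
  qed
  show ?thesis
    using e K lbs[OF kJ] len by (intro odd_typeI[of R i j "set J" K]) auto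
qed

end

section \<open>Two ears, and tripods\<close>

text \<open>
  Candidates for the first of two connecting paths. It should be short, to leave room for the second one, and is
  tested for being induced later.
\<close>

definition short_paths :: "('l \<Rightarrow> 'l list) \<Rightarrow> 'l \<Rightarrow> 'l \<Rightarrow> 'l list list" where
  "short_paths nb a c = (if a = c then [[a]] else if c \<in> set (nb a) then [[a, c]] else
     map (\<lambda>x. [a, x, c]) (filter (\<lambda>x. c \<in> set (nb x)) (nb a)) @
     concat (map (\<lambda>x. map (\<lambda>y. [a, x, y, c]) (filter (\<lambda>y. c \<in> set (nb y)) (nb x))) (nb a)))"

text \<open>
  There are two anticomplete induced paths of the base that avoid F, one from j to c and one from d to i. The
  second is sought in what remains after deleting the first and all its neighbours.
\<close>

definition linkage :: "('l \<Rightarrow> 'l list) \<Rightarrow> 'l list \<Rightarrow> 'l \<Rightarrow> 'l \<Rightarrow> 'l \<Rightarrow> 'l \<Rightarrow> 'l list \<Rightarrow> bool" where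
  "linkage nb us j c d i F \<longleftrightarrow> (\<exists>K\<in>set (short_paths nb j c). (\<forall>k\<in>set K. k \<notin> set F) \<and>
     ipath (\<lambda>x y. y \<in> set (nb x)) K \<and> linked nb us d i (F @ K @ concat (map nb K)))"

text \<open>
  The type of an ear: the labels of its ends and a list of the labels strictly inside.
\<close>

type_synonym 'l earc = "'l \<times> 'l \<times> 'l list"

fun two_ears_refuted :: "('l \<Rightarrow> 'l list) \<Rightarrow> 'l list \<Rightarrow> ('l \<times> 'l) list \<Rightarrow> 'l earc \<Rightarrow> 'l earc \<Rightarrow> bool" where
  "two_ears_refuted nb us X (i, j, I) (s, t, J) \<longleftrightarrow> forced_odd nb us X i j I \<and> forced_odd nb us X s t J \<and>
     (linkage nb us j s t i (I @ J) \<or> linkage nb us j t s i (I @ J) \<or>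
      linkage nb us i s t j (I @ J) \<or> linkage nb us i t s j (I @ J))"

text \<open>
  A word lists the labels along a leg in the order in which they first occur. Every entry is paired with the
  labels that precede it, which are the labels inside an ear that ends at this first occurrence.
\<close>

fun nodes :: "'l list \<Rightarrow> 'l list \<Rightarrow> ('l \<times> 'l list) list" where
  "nodes A [] = []"
| "nodes A (y # w) = (y, A) # nodes (A @ [y]) w"

definition heads :: "'l list \<Rightarrow> 'l list" where
  "heads w = (case w of [] \<Rightarrow> [] | h # _ \<Rightarrow> [h])"

definition heads_excluded :: "('l \<times> 'l) list \<Rightarrow> 'l list \<Rightarrow> 'l list \<Rightarrow> bool" where
  "heads_excluded Z v w \<longleftrightarrow> (\<exists>h\<in>set (heads v). \<exists>k\<in>set (heads w). among Z h k)"

text \<open>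
  The variant of the three-ear argument in which one end is the centre itself, labelled y.
\<close>

definition center_refuted where
  "center_refuted nb us X y v w \<longleftrightarrow> (\<exists>(a, A)\<in>set (nodes [] v). forced_odd nb us X y a A \<and>
     (\<exists>(d, D)\<in>set (nodes [] w). forced_odd nb us X y d D \<and> forced_odd nb us X a d (A @ D @ [y])))"

text \<open>
  A tripod is a vertex z with three legs whose labels read u, v and w; C holds the label of z, if any. Choosing
  a labelled vertex on each leg gives three ears, pairwise joining the legs through z. Their lengths have an odd
  sum, whereas three odd types would make it even, since going once around three labels changes colour an even
  number of times. If z is labelled it may itself serve as one of the three ends. A tripod is also impossible
  when it contains a clean ear between a pair of Z, the pairs for which clean ears have been excluded before.
\<close>

definition tripod_refuted :: "('l \<Rightarrow> 'l list) \<Rightarrow> 'l list \<Rightarrow> ('l \<times> 'l) list \<Rightarrow> ('l \<times> 'l) list \<Rightarrow>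
    'l list \<Rightarrow> 'l list \<Rightarrow> 'l list \<Rightarrow> 'l list \<Rightarrow> bool" where
  "tripod_refuted nb us X Z C u v w \<longleftrightarrow>
     (if C = [] then heads_excluded Z u v \<or> heads_excluded Z u w \<or> heads_excluded Z v w
      else heads_excluded Z C u \<or> heads_excluded Z C v \<or> heads_excluded Z C w) \<or>
     (\<exists>(a, A)\<in>set (nodes [] u). \<exists>(c, B)\<in>set (nodes [] v). forced_odd nb us X a c (A @ B @ C) \<and>
       (\<exists>(d, D)\<in>set (nodes [] w). forced_odd nb us X a d (A @ D @ C) \<and> forced_odd nb us X c d (B @ D @ C))) \<or>
     (case C of [] \<Rightarrow> False | y # _ \<Rightarrow>
       center_refuted nb us X y u v \<or> center_refuted nb us X y u w \<or> center_refuted nb us X y v w)"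

lemma short_paths_ends: "K \<in> set (short_paths nb a c) \<Longrightarrow> K \<noteq> [] \<and> hd K = a \<and> last K = c"
  by (auto simp: short_paths_def split: if_splits)

context odd_base begin

definition anticomplete where "anticomplete A B \<longleftrightarrow> A \<inter> B = {} \<and> (\<forall>x\<in>A. \<forall>y\<in>B. \<not> E x y)"

lemma anticomplete_mono: "anticomplete A B \<Longrightarrow> A' \<subseteq> A \<Longrightarrow> B' \<subseteq> B \<Longrightarrow> anticomplete A' B'"
  unfolding anticomplete_def by blast

lemma ear_cross:
  assumes "ear R i j J" "x \<in> set R" "k \<notin> J"
  shows "E x (b k) \<longleftrightarrow> (x = hd R \<and> k = i) \<or> (x = last R \<and> k = j)"
proof -
  obtain u M v where R: "R = u # M @ [v]" "ipath E R" "u \<in> Out" "v \<in> Out" "set M \<subseteq> Out"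
    "E u (b i)" "E v (b j)" "labels M = J" using assms(1) by (rule earE)
  have d: "u \<noteq> v" "u \<notin> set M" "v \<notin> set M" using ipath_distinct[OF R(2)] R(1) by auto
  have "\<not> E x (b k)" if "x \<in> set M" using that R(8) assms(3) by (auto simp: labels_def)
  moreover have "E u (b k) \<longleftrightarrow> k = i" "E v (b k) \<longleftrightarrow> k = j" using R one_label by auto
  ultimately show ?thesis using assms(2) R(1) d by auto
qed

text \<open>
  Closed by a geodesic, which has at most 5 vertices, an ear of odd type gives an odd cycle, hence one of length
  at least 9.
\<close>

lemma odd_type_length:
  assumes "ear R i j J" "odd_type R i j" shows "4 \<le> length R"
proof -
  obtain K where K: "K \<noteq> []" "ipath adj K" "hd K = j" "last K = i" "length K \<le> capped_dist nb j i + 1"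
    using geodesic by blast
  have "8 \<le> length R + length K" using ear_girth assms(1) K by blast
  moreover have "odd (length R + length K)"
    using col_path[OF ipath_successively[OF K(2)] K(1)] K assms(2) unfolding odd_type_def by auto
  ultimately show ?thesis using K(5) capped_dist_le[of j i] by presburger
qed

lemma ear_ends: "ear R i j J \<Longrightarrow> hd R \<noteq> last R \<and> hd R \<in> set R \<and> last R \<in> set R \<and> R \<noteq> []"
proof -
  assume "ear R i j J"
  then obtain u M v where R: "R = u # M @ [v]" "ipath E R" by (rule earE)
  then show ?thesis using ipath_distinct[OF R(2)] by auto
qed

text \<open>
  The ring R, K, S, L is an induced cycle. Both ears have odd type, so the total length is even, and the ears
  alone have at least 8 vertices.
\<close>

lemma two_ears:
  assumes R: "ear R i j I" "odd_type R i j" and S: "ear S s t J" "odd_type S s t"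
    and a: "anticomplete (set R) (set S)"
    and K: "ipath adj K" "K \<noteq> []" "hd K = j" "last K = s" "set K \<inter> (I \<union> J) = {}"
    and L: "ipath adj L" "L \<noteq> []" "hd L = t" "last L = i" "set L \<inter> (I \<union> J) = {}"
    and KL: "set K \<inter> set L = {}" "\<And>k l. k \<in> set K \<Longrightarrow> l \<in> set L \<Longrightarrow> \<not> adj k l"
  shows False
proof -
  have mem: "j \<in> set K" "s \<in> set K" "t \<in> set L" "i \<in> set L" using K L by auto
  have Ro: "set R \<subseteq> Out" "ipath E R" and So: "set S \<subseteq> Out" "ipath E S" using R S by (auto simp: ear_def)
  note en = ear_ends[OF R(1)] ear_ends[OF S(1)]
  have hl: "hd (map b K) = b j" "last (map b K) = b s" "hd (map b L) = b t" "last (map b L) = b i"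
    using K L by (auto simp: hd_map last_map)
  have RK: "ipath E (R @ map b K)"
  proof (subst ipath_append)
    show "ipath E R \<and> ipath E (map b K) \<and> set R \<inter> set (map b K) = {} \<and>
      (\<forall>x\<in>set R. \<forall>y\<in>set (map b K). E x y \<longleftrightarrow> x = last R \<and> y = hd (map b K))"
    proof (intro conjI ballI)
      fix x y assume x: "x \<in> set R" and "y \<in> set (map b K)"
      then obtain k where k: "k \<in> set K" "y = b k" by auto
      then have "k \<notin> I" "k \<noteq> i" using K KL mem by auto
      then show "E x y \<longleftrightarrow> x = last R \<and> y = hd (map b K)"
        using ear_cross[OF R(1) x, of k] k hl inj by (auto simp: inj_eq)
    qed (use Ro ipath_b K in \<open>auto simp: Out_def\<close>)
  qed (use en K in auto)
  have SL: "ipath E (S @ map b L)"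
  proof (subst ipath_append)
    show "ipath E S \<and> ipath E (map b L) \<and> set S \<inter> set (map b L) = {} \<and>
      (\<forall>x\<in>set S. \<forall>y\<in>set (map b L). E x y \<longleftrightarrow> x = last S \<and> y = hd (map b L))"
    proof (intro conjI ballI)
      fix x y assume x: "x \<in> set S" and "y \<in> set (map b L)"
      then obtain k where k: "k \<in> set L" "y = b k" by auto
      then have "k \<notin> J" "k \<noteq> s" using L KL mem by auto
      then show "E x y \<longleftrightarrow> x = last S \<and> y = hd (map b L)"
        using ear_cross[OF S(1) x, of k] k hl inj by (auto simp: inj_eq)
    qed (use So ipath_b L in \<open>auto simp: Out_def\<close>)
  qed (use en L in auto)
  have "length (R @ map b K) + length (S @ map b L) = 8"
  proof (rule ring_even[OF _ _ RK SL])
    show "set (R @ map b K) \<inter> set (S @ map b L) = {}"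
      using a Ro So KL inj by (auto simp: anticomplete_def Out_def inj_eq)
    show "3 \<le> length (R @ map b K) + length (S @ map b L)"
      using odd_type_length[OF R] by simp
    have "even (length R) \<longleftrightarrow> col i = col j" "even (length S) \<longleftrightarrow> col s = col t"
      using R(2) S(2) by (auto simp: odd_type_def)
    moreover have "even (length K) \<longleftrightarrow> col j \<noteq> col s" "even (length L) \<longleftrightarrow> col t \<noteq> col i"
      using col_path[OF ipath_successively[OF K(1)] K(2)] col_path[OF ipath_successively[OF L(1)] L(2)] K L
      by auto
    ultimately show "even (length (R @ map b K) + length (S @ map b L))" by auto
    fix x y assume x: "x \<in> set (R @ map b K)" and y: "y \<in> set (S @ map b L)"
    have ends: "hd (R @ map b K) = hd R" "last (R @ map b K) = b s"
      "hd (S @ map b L) = hd S" "last (S @ map b L) = b i"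
      using en K L by (auto simp: last_map)
    have no: "hd R \<noteq> b k" "hd S \<noteq> b k" for k using en Ro So by (auto simp: Out_def)
    consider (1) "x \<in> set R" "y \<in> set S" | (2) l where "x \<in> set R" "l \<in> set L" "y = b l"
      | (3) k where "k \<in> set K" "x = b k" "y \<in> set S" | (4) k l where "k \<in> set K" "x = b k" "l \<in> set L" "y = b l"
      using x y by auto
    then show "E x y \<longleftrightarrow> (x = last (R @ map b K) \<and> y = hd (S @ map b L)) \<or>
        (x = hd (R @ map b K) \<and> y = last (S @ map b L))"
    proof cases
      case 1
      then have "x \<noteq> b s" "y \<noteq> b i" using Ro So by (auto simp: Out_def)
      then show ?thesis using 1 a ends by (auto simp: anticomplete_def)
    next
      case 2
      then have "l \<notin> I" "l \<noteq> j" using L KL mem by auto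
      then have "E x y \<longleftrightarrow> x = hd R \<and> l = i" using ear_cross[OF R(1) 2(1)] 2 by auto
      moreover have "x \<noteq> b s" using 2 Ro by (auto simp: Out_def)
      moreover have "y \<noteq> hd S" using 2(3) no(2)[of l] by metis
      ultimately show ?thesis using ends 2(3) inj by (auto simp: inj_eq)
    next
      case 3
      then have "k \<notin> J" "k \<noteq> t" using K KL mem by auto
      then have "E y x \<longleftrightarrow> y = hd S \<and> k = s" using ear_cross[OF S(1) 3(3)] 3 by auto
      moreover have "y \<noteq> b i" using 3 So by (auto simp: Out_def)
      moreover have "x \<noteq> hd R" using 3(2) no(1)[of k] by metis
      ultimately show ?thesis using ends 3(2) inj E_comm by (auto simp: inj_eq)
    next
      case 4
      then have "\<not> E x y" using KL bE by auto
      then show ?thesis using 4 ends no by metis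
    qed
  qed (use en in auto)
  then show False using odd_type_length[OF R] odd_type_length[OF S] K(2) by (cases K) auto
qed

lemma linkage_sound:
  assumes R: "ear R i j (set I)" "odd_type R i j" and S: "ear S s t (set J)" "odd_type S s t"
    and a: "anticomplete (set R) (set S)" and l: "linkage nb us j s t i (I @ J)"
  shows False
proof -
  obtain K where K: "K \<in> set (short_paths nb j s)" "\<forall>k\<in>set K. k \<notin> set (I @ J)" "ipath adj K"
      "linked nb us t i ((I @ J) @ K @ concat (map nb K))"
    using l by (auto simp: linkage_def)
  obtain L where L: "L \<noteq> []" "ipath adj L" "hd L = t" "last L = i"
      "set L \<inter> set ((I @ J) @ K @ concat (map nb K)) = {}"
    using linked_sound[OF K(4)] by blast
  show False
    using short_paths_ends[OF K(1)] K L
    by (intro two_ears[OF R S a, of K L]) auto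
qed

lemma odd_type_rev: "odd_type R i j \<Longrightarrow> odd_type (rev R) j i"
  by (auto simp: odd_type_def)

lemma two_ears_refuted_sound:
  assumes R: "ear R i j (set I)" and S: "ear S s t (set J)"
    and a: "anticomplete (set R) (set S)" and t: "two_ears_refuted nb us X (i, j, I) (s, t, J)"
  shows False
proof -
  have o: "odd_type R i j" "odd_type S s t" using forced_odd_sound[OF R] forced_odd_sound[OF S] t by auto
  note R' = ear_rev[OF R] odd_type_rev[OF o(1)] and S' = ear_rev[OF S] odd_type_rev[OF o(2)]
  consider "linkage nb us j s t i (I @ J)" | "linkage nb us j t s i (I @ J)"
    | "linkage nb us i s t j (I @ J)" | "linkage nb us i t s j (I @ J)" using t by auto
  then show False
    using linkage_sound[OF R o(1) S o(2)] linkage_sound[OF R o(1) S'] linkage_sound[OF R' S o(2)]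
      linkage_sound[OF R' S'] a by cases auto
qed

text \<open>
  What an entry (y, A) of the list \<open>nodes\<close> means for a leg: an ear that ends at v has the labels A
  on this leg.
\<close>

definition node where
  "node l y A q \<longleftrightarrow> (\<exists>v r. l = q @ v # r \<and> E v (b y) \<and> labels q = set A)"

text \<open>
  Only a part of the labels of a leg needs to be read: the word lists labels from the centre outwards up to some
  point, and nothing is claimed beyond it.
\<close>

definition realizes where
  "realizes l w \<longleftrightarrow> (\<forall>(y, A)\<in>set (nodes [] w). \<exists>q. node l y A q)"

definition tripod where
  "tripod z l1 l2 l3 \<longleftrightarrow> ipath E (rev l1 @ z # l2) \<and> ipath E (rev l1 @ z # l3) \<and>
     ipath E (rev l2 @ z # l3) \<and> set (z # l1 @ l2 @ l3) \<subseteq> Out"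

lemma leg_ear:
  assumes "ipath E (rev l1 @ z # l2)" "set (z # l1 @ l2) \<subseteq> Out" "node l1 y A p" "node l2 x D q"
    and c: "labels [z] = set C"
  shows "\<exists>R. ear R y x (set (A @ D @ C)) \<and> length R = length p + length q + 3"
proof -
  obtain v r where 1: "l1 = p @ v # r" "E v (b y)" "labels p = set A" using assms(3) by (auto simp: node_def)
  obtain w s where 2: "l2 = q @ w # s" "E w (b x)" "labels q = set D" using assms(4) by (auto simp: node_def)
  have "rev l1 @ z # l2 = rev r @ (v # (rev p @ z # q) @ [w]) @ s" using 1 2 by simp
  then have "ipath E (v # (rev p @ z # q) @ [w])" using assms(1) ipath_appendD by metis
  then have "ear (v # (rev p @ z # q) @ [w]) y x (set (A @ D @ C))"
    using 1 2 assms(2) c by (intro earI) auto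
  then show ?thesis by (intro exI[of _ "v # (rev p @ z # q) @ [w]"]) auto
qed

lemma center_ear:
  assumes "ipath E (z # l)" "set (z # l) \<subseteq> Out" "E z (b c)" "node l y A q"
  shows "\<exists>R. ear R c y (set A) \<and> length R = length q + 2"
proof -
  obtain v r where 1: "l = q @ v # r" "E v (b y)" "labels q = set A" using assms(4) by (auto simp: node_def)
  have "ipath E (z # q @ [v])" using assms(1) 1 ipath_appendD[of E "z # q @ [v]" r] by simp
  then have "ear (z # q @ [v]) c y (set A)" using 1 assms by (intro earI) auto
  then show ?thesis by (intro exI[of _ "z # q @ [v]"]) auto
qed

lemma heads_node: "realizes l w \<Longrightarrow> h \<in> set (heads w) \<Longrightarrow> \<exists>q. node l h [] q"
  by (cases w) (auto simp: heads_def realizes_def)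

lemma heads_excluded_legs:
  assumes ex: "\<And>i j R. (i, j) \<in> set Z \<Longrightarrow> \<not> ear R i j {}"
    and "heads_excluded Z u v" "realizes l1 u" "realizes l2 v"
    "ipath E (rev l1 @ z # l2)" "set (z # l1 @ l2) \<subseteq> Out" "labels [z] = {}"
  shows False
proof -
  obtain h k where hk: "h \<in> set (heads u)" "k \<in> set (heads v)" "among Z h k"
    using assms(2) by (auto simp: heads_excluded_def)
  obtain p q where "node l1 h [] p" "node l2 k [] q" using heads_node assms(3,4) hk by blast
  then obtain R where "ear R h k {}" using leg_ear[OF assms(5,6), of h "[]" p k "[]" q "[]"] assms(7) by auto
  then show False using ex ear_rev hk(3) unfolding among_def by blast
qed

lemma heads_excluded_center:
  assumes ex: "\<And>i j R. (i, j) \<in> set Z \<Longrightarrow> \<not> ear R i j {}"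
    and "heads_excluded Z [c] v" "realizes l v" "ipath E (z # l)" "set (z # l) \<subseteq> Out" "E z (b c)"
  shows False
proof -
  obtain k where hk: "k \<in> set (heads v)" "among Z c k"
    using assms(2) by (auto simp: heads_excluded_def heads_def)
  obtain q where "node l k [] q" using heads_node assms(3) hk by blast
  then obtain R where "ear R c k {}" using center_ear[OF assms(4-6), of k "[]" q] by auto
  then show False using ex ear_rev hk(2) unfolding among_def by blast
qed

lemma center_refuted_sound:
  assumes "center_refuted nb us X y v w" "ipath E (rev l1 @ z # l2)" "set (z # l1 @ l2) \<subseteq> Out"
    "realizes l1 v" "realizes l2 w" "labels [z] = {y}"
  shows False
proof -
  obtain a A d D where n: "(a, A) \<in> set (nodes [] v)" "(d, D) \<in> set (nodes [] w)"
    and o: "forced_odd nb us X y a A" "forced_odd nb us X y d D" "forced_odd nb us X a d (A @ D @ [y])"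
    using assms(1) by (auto simp: center_refuted_def)
  obtain p q where pq: "node l1 a A p" "node l2 d D q" using n assms(4,5) by (fastforce simp: realizes_def)
  have i: "ipath E (z # l1)" "ipath E (z # l2)"
  proof -
    have "ipath E (rev (z # l1))" using assms(2) ipath_appendD[of E "rev l1 @ [z]" l2] by simp
    then show "ipath E (z # l1)" using ipath_rev[of E "z # l1"] sym by blast
    show "ipath E (z # l2)" using assms(2) ipath_appendD by blast
  qed
  have z: "E z (b y)" using assms(6) by auto
  obtain R1 where R1: "ear R1 y a (set A)" "length R1 = length p + 2"
    using center_ear[OF i(1) _ z pq(1)] assms(3) by auto
  obtain R2 where R2: "ear R2 y d (set D)" "length R2 = length q + 2"
    using center_ear[OF i(2) _ z pq(2)] assms(3) by auto
  obtain R3 where R3: "ear R3 a d (set (A @ D @ [y]))" "length R3 = length p + length q + 3"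
    using leg_ear[OF assms(2,3) pq, of "[y]"] assms(6) by auto
  show False
    using forced_odd_sound[OF R1(1) o(1)] forced_odd_sound[OF R2(1) o(2)] forced_odd_sound[OF R3(1) o(3)] R1(2) R2(2) R3(2)
    unfolding odd_type_def by auto
qed

lemma tripod_refuted_sound:
  assumes ex: "\<And>i j R. (i, j) \<in> set Z \<Longrightarrow> \<not> ear R i j {}"
    and t: "tripod z l1 l2 l3" and r: "realizes l1 u" "realizes l2 v" "realizes l3 w"
    and C: "labels [z] = set C" "length C \<le> 1" and c: "tripod_refuted nb us X Z C u v w"
  shows False
proof -
  have i: "ipath E (rev l1 @ z # l2)" "ipath E (rev l1 @ z # l3)" "ipath E (rev l2 @ z # l3)"
    and o: "set (z # l1 @ l2) \<subseteq> Out" "set (z # l1 @ l3) \<subseteq> Out" "set (z # l2 @ l3) \<subseteq> Out"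
    using t by (auto simp: tripod_def)
  have iz: "ipath E (z # l1)" "ipath E (z # l2)" "ipath E (z # l3)"
  proof -
    have "ipath E (rev (z # l1))" using i(1) ipath_appendD[of E "rev l1 @ [z]" l2] by simp
    then show "ipath E (z # l1)" using ipath_rev[of E "z # l1"] sym by blast
    show "ipath E (z # l2)" "ipath E (z # l3)" using i ipath_appendD by blast+
  qed
  consider (h) "if C = [] then heads_excluded Z u v \<or> heads_excluded Z u w \<or> heads_excluded Z v w
      else heads_excluded Z C u \<or> heads_excluded Z C v \<or> heads_excluded Z C w"
    | (t) a A x B d D where "(a, A) \<in> set (nodes [] u)" "(x, B) \<in> set (nodes [] v)" "(d, D) \<in> set (nodes [] w)"
       "forced_odd nb us X a x (A @ B @ C)" "forced_odd nb us X a d (A @ D @ C)" "forced_odd nb us X x d (B @ D @ C)"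
    | (k) "case C of [] \<Rightarrow> False | y # _ \<Rightarrow> center_refuted nb us X y u v \<or> center_refuted nb us X y u w \<or> center_refuted nb us X y v w"
    using c unfolding tripod_refuted_def by (elim disjE) (blast | auto)+
  then show False
  proof cases
    case h
    show False
    proof (cases "C = []")
      case True
      then show False using h heads_excluded_legs[OF ex _ r(1,2) i(1) o(1)] heads_excluded_legs[OF ex _ r(1,3) i(2) o(2)]
          heads_excluded_legs[OF ex _ r(2,3) i(3) o(3)] C(1) by auto
    next
      case False
      then obtain y where y: "C = [y]" using C(2) by (cases C) auto
      then have z: "E z (b y)" using C(1) by auto
      show False using h y heads_excluded_center[OF ex _ r(1) iz(1) _ z] heads_excluded_center[OF ex _ r(2) iz(2) _ z]
          heads_excluded_center[OF ex _ r(3) iz(3) _ z] o by auto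
    qed
  next
    case k
    then obtain y where y: "C = [y]" using C(2) by (cases C) auto
    then show False using k center_refuted_sound[OF _ i(1) o(1) r(1,2)] center_refuted_sound[OF _ i(2) o(2) r(1,3)]
        center_refuted_sound[OF _ i(3) o(3) r(2,3)] C(1) by auto
  next
    case t
    obtain p q s where n: "node l1 a A p" "node l2 x B q" "node l3 d D s"
      using t r by (fastforce simp: realizes_def)
    obtain R1 where R1: "ear R1 a x (set (A @ B @ C))" "length R1 = length p + length q + 3"
      using leg_ear[OF i(1) o(1) n(1,2) C(1)] by blast
    obtain R2 where R2: "ear R2 a d (set (A @ D @ C))" "length R2 = length p + length s + 3"
      using leg_ear[OF i(2) o(2) n(1,3) C(1)] by blast
    obtain R3 where R3: "ear R3 x d (set (B @ D @ C))" "length R3 = length q + length s + 3"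
      using leg_ear[OF i(3) o(3) n(2,3) C(1)] by blast
    show False
      using forced_odd_sound[OF R1(1) t(4)] forced_odd_sound[OF R2(1) t(5)] forced_odd_sound[OF R3(1) t(6)] R1(2) R2(2) R3(2)
      unfolding odd_type_def by auto
  qed
qed

end

section \<open>Paths that touch an ear\<close>

text \<open>
  How a leg that starts outside and arrives at a vertex labelled m can read if its labels up to there are
  confined to m and one neighbour of m.
\<close>

definition tail_words :: "('l \<Rightarrow> 'l list) \<Rightarrow> 'l \<Rightarrow> 'l list list" where
  "tail_words nb m = [m] # map (\<lambda>c. [c, m]) (nb m)"

text \<open>
  How the part of an ear between a cut point and an end labelled z can read, seen from the cut point, if the
  inside of the ear carries the labels I, at most one.
\<close>

definition leg_words :: "'l list \<Rightarrow> 'l \<Rightarrow> 'l list list" where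
  "leg_words I z = [z] # map (\<lambda>x. [x, z]) I"

text \<open>
  A path comes from a vertex labelled m and touches an ear of type (i, j, I) at its other end t. All tripods
  that may arise are to be impossible. If t sees a single vertex r of the ear, the centre is r, which is an end
  labelled i or j, a vertex inside labelled x, or unlabelled. If t sees several vertices of the ear, the centre
  is t. When t is labelled q and r is not labelled, both r and t can be taken as the centre, and it suffices
  that one of the choices is impossible.
\<close>

fun touch_refuted ::
  "('l \<Rightarrow> 'l list) \<Rightarrow> 'l list \<Rightarrow> ('l \<times> 'l) list \<Rightarrow> ('l \<times> 'l) list \<Rightarrow> 'l earc \<Rightarrow> 'l \<Rightarrow> bool"
where
  "touch_refuted nb us X Z (i, j, I) m \<longleftrightarrow>
    m \<noteq> i \<and> m \<noteq> j \<and> m \<notin> set I \<and> i \<notin> set I \<and> j \<notin> set I \<and> length I \<le> 1 \<and>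
    (\<forall>t\<in>set (tail_words nb m).
      (\<forall>u\<in>set (leg_words I i). tripod_refuted nb us X Z [j] u [] t \<and>
        (\<forall>v\<in>set (leg_words I j). tripod_refuted nb us X Z [] u v t \<and>
          (\<forall>x\<in>set I. tripod_refuted nb us X Z [x] u v t))) \<and>
      (\<forall>v\<in>set (leg_words I j). tripod_refuted nb us X Z [i] v [] t)) \<and>
    (\<forall>q\<in>set us. \<forall>t\<in>set (if q = m then [[]] else tail_words nb m).
      \<forall>u\<in>set (leg_words I i). \<forall>v\<in>set (leg_words I j). tripod_refuted nb us X Z [q] u v t \<and>
        (tripod_refuted nb us X Z [] u v (q # t) \<or> tripod_refuted nb us X Z [q] u [] t \<or>
         tripod_refuted nb us X Z [q] v [] t))"

text \<open>
  The types of ears that exploring from m can produce. Labels on the path seen so far are confined to m and one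
  neighbour x when the first offending label q is met. If q is not adjacent to m, the ear from the last m to q
  has no label inside, or only x; in the latter case its part from the last x to q is a clean ear as well, which
  is of use unless x and q are adjacent. If q is another neighbour of m, the ear from the last x to q has no
  label inside, or only m.
\<close>

definition outcomes :: "('l \<Rightarrow> 'l list) \<Rightarrow> 'l list \<Rightarrow> 'l \<Rightarrow> 'l earc list list" where
  "outcomes nb us m =
     concat (map (\<lambda>q. [(m, q, [])] #
         map (\<lambda>x. if q \<in> set (nb x) then [(m, q, [x])] else [(m, q, [x]), (x, q, [])]) (nb m))
       (filter (\<lambda>q. q \<noteq> m \<and> q \<notin> set (nb m)) us)) @
     concat (map (\<lambda>x. concat (map (\<lambda>q. [[(x, q, [])], [(x, q, [m])]]) (filter (\<lambda>q. q \<noteq> x) (nb m)))) (nb m))"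

lemma outcomes_clean: "q \<in> set us \<Longrightarrow> q \<noteq> m \<Longrightarrow> q \<notin> set (nb m) \<Longrightarrow> [(m, q, [])] \<in> set (outcomes nb us m)"
  by (auto simp: outcomes_def)

lemma outcomes_far: "q \<in> set us \<Longrightarrow> q \<noteq> m \<Longrightarrow> q \<notin> set (nb m) \<Longrightarrow> x \<in> set (nb m) \<Longrightarrow>
   (if q \<in> set (nb x) then [(m, q, [x])] else [(m, q, [x]), (x, q, [])]) \<in> set (outcomes nb us m)"
  unfolding outcomes_def set_append set_concat set_map by (rule UnI1) auto

lemma outcomes_near: "x \<in> set (nb m) \<Longrightarrow> q \<in> set (nb m) \<Longrightarrow> x \<noteq> q \<Longrightarrow>
   [(x, q, [])] \<in> set (outcomes nb us m) \<and> [(x, q, [m])] \<in> set (outcomes nb us m)"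
  unfolding outcomes_def set_append set_concat set_map by auto

definition excluded :: "('l \<times> 'l) list \<Rightarrow> 'l earc list \<Rightarrow> bool" where
  "excluded Z g \<longleftrightarrow> (\<exists>(i, j, I)\<in>set g. I = [] \<and> among Z i j)"

text \<open>
  Ears found in different explorations are anticomplete, so a linked pair of them is impossible.
\<close>

definition clash where
  "clash nb us X g h \<longleftrightarrow> (\<exists>e\<in>set g. \<exists>f\<in>set h. two_ears_refuted nb us X e f)"

text \<open>
  A finite game. In each round a start m is chosen among the candidates M. Whatever the exploration from m does
  must be impossible at once or be refuted in the remaining rounds: touching an earlier ear, or producing a
  further ear that is anticomplete to all earlier ones. The list gs collects the ears found, each with the ears
  contained in it.
\<close>

fun refuted ::
  "('l \<Rightarrow> 'l list) \<Rightarrow> 'l list \<Rightarrow> ('l \<times> 'l) list \<Rightarrow> ('l \<times> 'l) list \<Rightarrow> 'l list list \<Rightarrow> 'l earc list list \<Rightarrow> bool"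
where
  "refuted nb us X Z [] gs = False"
| "refuted nb us X Z (M # Ms) gs \<longleftrightarrow>
     (\<exists>m\<in>set M. nb m \<noteq> [] \<and> (\<forall>g\<in>set gs. touch_refuted nb us X Z (hd g) m) \<and>
       (\<forall>h\<in>set (outcomes nb us m). excluded Z h \<or> (\<exists>g\<in>set gs. clash nb us X g h) \<or>
         refuted nb us X Z Ms (h # gs)))"

lemma nodes_shift: "nodes (B @ A) w = map (\<lambda>(y, C). (y, B @ C)) (nodes A w)"
  by (induction w arbitrary: A) auto

context odd_base begin

lemma labels_mem: "k \<in> labels xs \<longleftrightarrow> (\<exists>v\<in>set xs. E v (b k))" by (simp add: labels_def)

lemma realizes_Nil [simp]: "realizes l []" by (simp add: realizes_def)

lemma realizes_single: "E v (b i) \<Longrightarrow> labels q = {} \<Longrightarrow> realizes (q @ v # r) [i]"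
  by (auto simp: realizes_def node_def)

lemma realizes_pair:
  "E v (b x) \<Longrightarrow> labels q = {} \<Longrightarrow> E w (b i) \<Longrightarrow> labels p = {x} \<Longrightarrow> l = q @ v # r \<Longrightarrow> l = p @ w # s
   \<Longrightarrow> realizes l [x, i]"
proof -
  assume a: "E v (b x)" "labels q = {}" "E w (b i)" "labels p = {x}" "l = q @ v # r" "l = p @ w # s"
  have "node l x [] q" unfolding node_def using a(1,2,5) by auto
  moreover have "node l i [x] p" unfolding node_def using a(3,4,6) by auto
  ultimately show ?thesis by (auto simp: realizes_def)
qed

lemma first_label:
  assumes "labels l \<noteq> {}"
  obtains q v r k where "l = q @ v # r" "E v (b k)" "labels q = {}"
proof -
  have "\<exists>v\<in>set l. \<exists>k. E v (b k)" using assms by (auto simp: labels_def)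
  from split_list_first_prop[OF this] show ?thesis using that by (force simp: labels_def)
qed

lemma first_label_eq:
  assumes "k \<in> labels l"
  obtains q v r where "l = q @ v # r" "E v (b k)" "k \<notin> labels q"
proof -
  have "\<exists>v\<in>set l. E v (b k)" using assms by (auto simp: labels_def)
  from split_list_first_prop[OF this] show ?thesis using that by (force simp: labels_def)
qed

lemma last_label_eq:
  assumes "k \<in> labels l"
  obtains q v r where "l = q @ v # r" "E v (b k)" "k \<notin> labels r"
proof -
  have "\<exists>v\<in>set l. E v (b k)" using assms by (auto simp: labels_def)
  from split_list_last_prop[OF this] show ?thesis using that by (force simp: labels_def)
qed

lemma legword:
  assumes "l = q @ [v]" "E v (b i)" "labels q \<subseteq> set I" "length I \<le> 1"
  shows "\<exists>u\<in>set (leg_words I i). realizes l u"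
proof (cases "labels q = {}")
  case True
  then show ?thesis using assms realizes_single[of v i q "[]"] by (auto simp: leg_words_def)
next
  case False
  then obtain x where I: "I = [x]" using assms(3,4) by (cases I) auto
  obtain p w r k where f: "q = p @ w # r" "E w (b k)" "labels p = {}" using first_label[OF False] by blast
  then have "k = x" "labels q = {x}" using assms(3) I by auto
  then have "realizes l [x, i]" using f assms(1,2)
    by (intro realizes_pair[of w x p v i q l "r @ [v]" "[]"]) auto
  then show ?thesis using I by (auto simp: leg_words_def)
qed

lemma tailword:
  assumes "T \<noteq> []" "E (last T) (b m)" "labels T \<subseteq> {m, x}" "x \<in> set (nb m)"
  shows "\<exists>t\<in>set (tail_words nb m). realizes T t"
proof -
  have mT: "m \<in> labels T" using assms(1,2) by (auto simp: labels_mem)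
  obtain p w r where g: "T = p @ w # r" "E w (b m)" "m \<notin> labels p" using first_label_eq[OF mT] by blast
  have px: "labels p \<subseteq> {x}" using assms(3) g by auto
  show ?thesis
  proof (cases "labels p = {}")
    case True
    then have "realizes T [m]" using g realizes_single by auto
    then show ?thesis by (auto simp: tail_words_def)
  next
    case False
    obtain q v s k where f: "p = q @ v # s" "E v (b k)" "labels q = {}" using first_label[OF False] by blast
    then have "k = x" "labels p = {x}" using px by auto
    then have "realizes T [x, m]" using f g
      by (intro realizes_pair[of v x q w m p T "s @ w # r" r]) auto
    then show ?thesis using assms(4) by (auto simp: tail_words_def)
  qed
qed

lemma realizes_Cons_unlabelled: "realizes T t \<Longrightarrow> labels [z] = {} \<Longrightarrow> realizes (z # T) t"
  unfolding realizes_def node_def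
proof (intro ballI, clarify)
  fix y A assume a: "\<forall>(y, A)\<in>set (nodes [] t). \<exists>q v r. T = q @ v # r \<and> E v (b y) \<and> labels q = set A"
    "labels [z] = {}" "(y, A) \<in> set (nodes [] t)"
  then obtain q v r where "T = q @ v # r" "E v (b y)" "labels q = set A" by blast
  then show "\<exists>q v r. z # T = q @ v # r \<and> E v (b y) \<and> labels q = set A"
    using a(2) by (intro exI[of _ "z # q"]) auto
qed

lemma realizes_Cons_labelled: "realizes T t \<Longrightarrow> labels [z] = {k} \<Longrightarrow> realizes (z # T) (k # t)"
  unfolding realizes_def
proof (intro ballI, clarify)
  fix y A assume a: "\<forall>(y, A)\<in>set (nodes [] t). \<exists>q. node T y A q" "labels [z] = {k}" "(y, A) \<in> set (nodes [] (k # t))"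
  then consider "y = k" "A = []" | B where "A = k # B" "(y, B) \<in> set (nodes [] t)"
    using nodes_shift[of "[k]" "[]" t] by auto
  then show "\<exists>q. node (z # T) y A q"
  proof cases
    case 1
    then show ?thesis using a(2) by (intro exI[of _ "[]"]) (auto simp: node_def)
  next
    case 2
    then obtain q where "node T y B q" using a(1) by blast
    then show ?thesis using a(2) 2 unfolding node_def by (intro exI[of _ "z # q"]) auto
  qed
qed

lemma no_triangle: "E x y \<Longrightarrow> E y z \<Longrightarrow> E z x \<Longrightarrow> False"
  using ring_girth[of "[x]" "[y, z]"] irr by auto

lemma ipath_revI: "ipath E xs \<Longrightarrow> ipath E (rev xs)"
  using ipath_rev[of E xs] sym by blast

lemma ipath_attach:
  assumes "ipath E (P @ [z])" "ipath E T" "T \<noteq> []" "E (hd T) z" "set T \<inter> set (P @ [z]) = {}"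
    "\<And>x. x \<in> set P \<Longrightarrow> \<not> E (hd T) x" "\<And>x y. x \<in> set (P @ [z]) \<Longrightarrow> y \<in> set (tl T) \<Longrightarrow> \<not> E y x"
  shows "ipath E (P @ z # T)"
proof -
  have d: "hd T \<notin> set (tl T)" "z \<notin> set P" using assms(1,2,3) ipath_distinct[of E T] ipath_distinct[of E "P @ [z]"]
    by (cases T; auto)+
  have T: "set T = insert (hd T) (set (tl T))" using assms(3) by (cases T) auto
  have "ipath E ((P @ [z]) @ T)"
  proof (subst ipath_append)
    show "ipath E (P @ [z]) \<and> ipath E T \<and> set (P @ [z]) \<inter> set T = {} \<and>
        (\<forall>x\<in>set (P @ [z]). \<forall>y\<in>set T. E x y \<longleftrightarrow> x = last (P @ [z]) \<and> y = hd T)"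
    proof (intro conjI ballI)
      fix x y assume x: "x \<in> set (P @ [z])" and y: "y \<in> set T"
      show "E x y \<longleftrightarrow> x = last (P @ [z]) \<and> y = hd T"
      proof (cases "y = hd T")
        case True
        then show ?thesis using assms(4,6) x d E_comm by auto
      next
        case False
        then show ?thesis using assms(7)[OF x, of y] y T E_comm by auto
      qed
    qed (use assms in auto)
  qed (use assms in auto)
  then show ?thesis by simp
qed

text \<open>
  The touching path together with the ear forms a tripod; which vertex is the centre depends on the number of
  neighbours of t on the ear.
\<close>

lemma touch_sound:
  assumes Z: "\<And>i j R. (i, j) \<in> set Z \<Longrightarrow> \<not> ear R i j {}"
    and e: "ear R i j (set I)" and tr: "touch_refuted nb us X Z (i, j, I) m"
    and T: "ipath E (t # T)" "set (t # T) \<subseteq> Out" "t \<notin> set R" "\<exists>r\<in>set R. E t r"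
    and T': "\<And>y r. y \<in> set T \<Longrightarrow> r \<in> set R \<Longrightarrow> y \<noteq> r \<and> \<not> E y r"
    and m: "E (last (t # T)) (b m)" "labels T \<subseteq> {m, x}" "x \<in> set (nb m)"
  shows False
proof -
  have R: "ipath E R" "set R \<subseteq> Out" "2 \<le> length R" "E (hd R) (b i)" "E (last R) (b j)"
    "labels (butlast (tl R)) = set I" using e by (auto simp: ear_def)
  have I: "length I \<le> 1" "i \<notin> set I" "j \<notin> set I" using tr by auto
  have okq: "tripod_refuted nb us X Z [q] u v w"
    "tripod_refuted nb us X Z [] u v (q # w) \<or> tripod_refuted nb us X Z [q] u [] w \<or> tripod_refuted nb us X Z [q] v [] w"
    if "w \<in> set (if q = m then [[]] else tail_words nb m)" "u \<in> set (leg_words I i)" "v \<in> set (leg_words I j)" for q u v w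
  proof -
    have "q \<in> set us" using us by simp
    with tr that show "tripod_refuted nb us X Z [q] u v w"
      "tripod_refuted nb us X Z [] u v (q # w) \<or> tripod_refuted nb us X Z [q] u [] w \<or> tripod_refuted nb us X Z [q] v [] w"
      unfolding touch_refuted.simps by blast+
  qed
  have okt: "tripod_refuted nb us X Z [j] u [] w" "tripod_refuted nb us X Z [i] v [] w" "tripod_refuted nb us X Z [] u v w"
    "\<And>y. y \<in> set I \<Longrightarrow> tripod_refuted nb us X Z [y] u v w"
    if "w \<in> set (tail_words nb m)" "u \<in> set (leg_words I i)" "v \<in> set (leg_words I j)" for u v w
    using tr that unfolding touch_refuted.simps by blast+
  have tlab: "labels [t] = {} \<or> (\<exists>q. labels [t] = {q})" using label_set[of t] T(2) by auto
  have w0: "\<exists>w\<in>set (tail_words nb m). realizes T w" if "labels [t] \<noteq> {m}"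
  proof -
    have "T \<noteq> []" using that m(1) label_set[of t m] T(2) by auto
    then show ?thesis using tailword[of T m x] m by auto
  qed
  have wq: "\<exists>w\<in>set (if q = m then [[]] else tail_words nb m). realizes T w" if "labels [t] = {q}" for q
  proof (cases "q = m")
    case False
    then show ?thesis using w0 that by auto
  qed auto
  \<comment> \<open>Adjacent outside vertices are not both labelled.\<close>
  have Rt: "\<not> E r t" if rk: "r \<in> set R" "E r (b k)" and tl: "labels [t] \<noteq> {}" for r k
  proof
    assume "E r t"
    obtain q where "E t (b q)" using tl by auto
    then show False using adjacent_labels[of r t k q] \<open>E r t\<close> rk R(2) T(2) by auto
  qed
  \<comment> \<open>words of the two legs cut out of R\<close>
  have legL: "\<exists>u\<in>set (leg_words I i). realizes (rev P) u" if "R = P @ z # Q" "P \<noteq> []" "Q \<noteq> []" for P z Q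
  proof -
    obtain a P' where P': "P = a # P'" using \<open>P \<noteq> []\<close> by (cases P) auto
    have "set P' \<subseteq> set (butlast (tl R))" using that P' by (auto simp: butlast_append)
    then have "labels (rev P') \<subseteq> set I" using R(6) by (auto simp: labels_def)
    then show ?thesis using legword[of "rev P" "rev P'" a i I] that P' R(4) I by auto
  qed
  have legR: "\<exists>v\<in>set (leg_words I j). realizes Q v" if "R = P @ z # Q" "P \<noteq> []" "Q \<noteq> []" for P z Q
  proof -
    obtain a Q' where Q': "Q = Q' @ [a]" using \<open>Q \<noteq> []\<close> by (metis append_butlast_last_id)
    have "set Q' \<subseteq> set (butlast (tl R))" using that Q' by (cases P) (auto simp: butlast_append)
    then have "labels Q' \<subseteq> set I" using R(6) by (auto simp: labels_def)
    then show ?thesis using legword[of Q Q' a j I] that Q' R(5) I by auto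
  qed
  obtain P r S where s1: "R = P @ r # S" "E t r" "\<forall>y\<in>set P. \<not> E t y"
    using split_list_first_prop[OF T(4)] by blast
  have att: "ipath E (A @ z # t # T)"
    if iA: "ipath E (A @ [z])" and AR: "set (A @ [z]) \<subseteq> set R" and tz: "E t z" and tA: "\<And>y. y \<in> set A \<Longrightarrow> \<not> E t y" for A z
  proof (rule ipath_attach[OF iA T(1)])
    show "E (hd (t # T)) z" using tz by simp
    show "set (t # T) \<inter> set (A @ [z]) = {}" using T(3) T' AR by fastforce
    show "\<not> E (hd (t # T)) x" if "x \<in> set A" for x using tA that by simp
    show "\<not> E y x" if "x \<in> set (A @ [z])" "y \<in> set (tl (t # T))" for x y
      using T'[of y x] that AR by auto
  qed simp
  show False
  proof (cases "\<exists>y\<in>set S. E t y")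
    case False
    \<comment> \<open>t sees R only in r, which becomes the centre\<close>
    have tr: "\<not> E t y" if "y \<in> set P \<union> set S" for y using that s1(3) False by auto
    have iP: "ipath E (P @ [r])" "ipath E (rev S @ [r])"
      using R(1) s1(1) ipath_appendD[of E "P @ [r]" S] ipath_appendD[of E P "r # S"] ipath_revI[of "r # S"] by auto
    have dR: "r \<notin> set P" "r \<notin> set S" using ipath_distinct[OF R(1)] s1(1) by auto
    have a1: "ipath E (P @ r # t # T)"
      using att[OF iP(1)] tr s1(1,2) by auto
    have a2: "ipath E (rev S @ r # t # T)"
      using att[OF iP(2)] tr s1(1,2) by auto
    have out: "set (r # rev P @ S @ t # T) \<subseteq> Out" using R(2) T(2) s1(1) by auto
    have ri: "labels [r] = {i}" if "P = []" using that s1(1) R(4) label_set[of r i] out by auto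
    have rj: "labels [r] = {j}" if "S = []" using that s1(1) R(5) label_set[of r j] out by auto
    have unl: "labels [t] = {}" if "E r (b k)" for k using Rt[of r k] that s1 E_comm by auto
    consider (L) "P = []" | (Rr) "S = []" | (M) "P \<noteq> []" "S \<noteq> []" by blast
    then show False
    proof cases
      case L
      have t0: "labels [t] = {}" using unl[of i] ri[OF L] by auto
      obtain w where w: "w \<in> set (tail_words nb m)" "realizes (t # T) w"
        using w0 t0 realizes_Cons_unlabelled by fastforce
      obtain a S' where S': "S = S' @ [a]" using L s1(1) R(3) by (cases S rule: rev_cases) auto
      have "set S' \<subseteq> set (butlast (tl R))" using s1(1) L S' by (auto simp: butlast_append)
      then have "labels S' \<subseteq> set I" using R(6) by (auto simp: labels_def)
      then obtain v where v: "v \<in> set (leg_words I j)" "realizes S v"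
        using legword[of S S' a j I] S' s1(1) R(5) I by auto
      have "tripod r S [] (t # T)" unfolding tripod_def
        using a1 a2 L iP out by auto
      then show False
        using tripod_refuted_sound[OF Z _ v(2) realizes_Nil w(2), where z=r and C="[i]"] ri[OF L] okt(2)[OF w(1) _ v(1), of "[i]"]
        by (auto simp: leg_words_def)
    next
      case Rr
      have t0: "labels [t] = {}" using unl[of j] rj[OF Rr] by auto
      obtain w where w: "w \<in> set (tail_words nb m)" "realizes (t # T) w"
        using w0 t0 realizes_Cons_unlabelled by fastforce
      obtain a P' where P': "P = a # P'" using Rr s1(1) R(3) by (cases P) auto
      have "set P' \<subseteq> set (butlast (tl R))" using s1(1) Rr P' by (auto simp: butlast_append)
      then have "labels (rev P') \<subseteq> set I" using R(6) by (auto simp: labels_def)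
      then obtain u where u: "u \<in> set (leg_words I i)" "realizes (rev P) u"
        using legword[of "rev P" "rev P'" a i I] P' s1(1) R(4) I by auto
      have "tripod r (rev P) [] (t # T)" unfolding tripod_def
        using a1 a2 Rr iP out by auto
      then show False
        using tripod_refuted_sound[OF Z _ u(2) realizes_Nil w(2), where z=r and C="[j]"] rj[OF Rr] okt(1)[OF w(1) u(1), of "[j]"]
        by (auto simp: leg_words_def)
    next
      case M
      obtain u where u: "u \<in> set (leg_words I i)" "realizes (rev P) u" using legL[OF s1(1) M] by blast
      obtain v where v: "v \<in> set (leg_words I j)" "realizes S v" using legR[OF s1(1) M] by blast
      have tri: "tripod r (rev P) S (t # T)" unfolding tripod_def
        using a1 a2 R(1) s1(1) out by auto
      show False
      proof (cases "labels [r] = {}")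
        case False
        then obtain k where k: "E r (b k)" by auto
        have "r \<in> set (butlast (tl R))" using s1(1) M by (cases P) (auto simp: butlast_append)
        then have kI: "k \<in> set I" using R(6) k by (auto simp: labels_def)
        have "labels [r] = {k}" using k label_set[of r k] out by auto
        moreover have t0: "labels [t] = {}" using unl[OF k] .
        moreover obtain w where w: "w \<in> set (tail_words nb m)" "realizes (t # T) w"
          using w0 t0 realizes_Cons_unlabelled by fastforce
        ultimately show False
          using tripod_refuted_sound[OF Z tri u(2) v(2) w(2), where C="[k]"] okt(4)[OF w(1) u(1) v(1) kI] by auto
      next
        case r0: True
        show False
        proof (cases "labels [t] = {}")
          case True
          then obtain w where w: "w \<in> set (tail_words nb m)" "realizes (t # T) w"
            using w0 realizes_Cons_unlabelled by fastforce
          then show False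
            using tripod_refuted_sound[OF Z tri u(2) v(2) w(2), where C="[]"] okt(3)[OF w(1) u(1) v(1)] r0 by auto
        next
          case False
          then obtain q where q: "labels [t] = {q}" using tlab by auto
          obtain w where w: "w \<in> set (if q = m then [[]] else tail_words nb m)" "realizes T w" using wq[OF q] by blast
          have tt: "tripod t (r # rev P) [] T" "tripod t (r # S) [] T"
          proof -
            have "ipath E (P @ [r] @ [t])" using a1 ipath_appendD[of E "P @ [r, t]" T] by simp
            then show "tripod t (r # rev P) [] T" unfolding tripod_def using a1 T(1) out by auto
            have "ipath E (rev S @ [r] @ [t])" using a2 ipath_appendD[of E "rev S @ [r, t]" T] by simp
            then show "tripod t (r # S) [] T" unfolding tripod_def using a2 T(1) out by auto
          qed
          have "realizes (r # rev P) u" "realizes (r # S) v" "realizes (t # T) (q # w)"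
            using u v w r0 q realizes_Cons_unlabelled realizes_Cons_labelled by auto
          then show False
            using okq(2)[OF w(1) u(1) v(1)] tripod_refuted_sound[OF Z tri u(2) v(2), where w="q # w" and C="[]"]
              tripod_refuted_sound[OF Z tt(1) _ realizes_Nil w(2), where u=u and C="[q]"]
              tripod_refuted_sound[OF Z tt(2) _ realizes_Nil w(2), where u=v and C="[q]"] r0 q by auto
        qed
      qed
    qed
  next
    case True
    \<comment> \<open>t sees R at least twice and becomes the centre itself\<close>
    from split_list_last_prop[OF True]
    obtain M r' Q where s2: "S = M @ r' # Q" "E t r'" "\<forall>y\<in>set Q. \<not> E t y" by blast
    have RR: "R = (P @ [r]) @ (M @ r' # Q)" using s1(1) s2(1) by simp
    have dR: "distinct R" using ipath_distinct[OF R(1)] .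
    have cr: "E x y \<longleftrightarrow> x = r \<and> y = hd (M @ r' # Q)" if "x \<in> set (P @ [r])" "y \<in> set (M @ r' # Q)" for x y
      using that R(1) ipath_append[of "P @ [r]" "M @ r' # Q" E] unfolding RR by auto
    \<comment> \<open>The two extreme neighbours of t on the ear are not adjacent, for there is no triangle.\<close>
    have Mne: "M \<noteq> []"
    proof
      assume "M = []"
      then have "E r r'" using cr[of r r'] by auto
      then show False using no_triangle[of t r r'] s1(2) s2(2) sym by blast
    qed
    then have hM: "hd (M @ r' # Q) \<in> set M" by simp
    have no: "\<not> E x y" if "x \<in> set (P @ [r])" "y \<in> set (r' # Q)" for x y
      using cr[of x y] that hM dR RR by auto
    have iL: "ipath E (P @ [r])" "ipath E (r' # Q)" "ipath E (rev Q @ [r'])"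
      using R(1) ipath_appendD[of E "P @ [r]" "M @ r' # Q"] ipath_appendD[of E "(P @ [r]) @ M" "r' # Q"]
        ipath_revI[of "r' # Q"] unfolding RR by auto
    have tP: "E t y \<longleftrightarrow> y = r" if "y \<in> set (P @ [r])" for y using that s1 by auto
    have tQ: "E t y \<longleftrightarrow> y = r'" if "y \<in> set (r' # Q)" for y using that s2 by auto
    have itr: "ipath E (t # r' # Q)" using iL(2) tQ T(3) RR by auto
    have b1: "ipath E (P @ r # t # T)"
      using att[OF iL(1)] s1 by auto
    have b2: "ipath E (rev Q @ r' # t # T)"
      using att[OF iL(3)] s2 RR by auto
    have b3: "ipath E (P @ r # t # r' # Q)"
    proof (rule ipath_attach[OF iL(1) itr])
      show "E (hd (t # r' # Q)) r" using s1(2) by simp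
      show "set (t # r' # Q) \<inter> set (P @ [r]) = {}" using T(3) dR RR by auto
      show "\<not> E (hd (t # r' # Q)) x" if "x \<in> set P" for x using s1(3) that by simp
      show "\<not> E y x" if "x \<in> set (P @ [r])" "y \<in> set (tl (t # r' # Q))" for x y
        using no[of x y] that E_comm[of x y] by auto
    qed simp
    have tri: "tripod t (rev (P @ [r])) (r' # Q) T"
      unfolding tripod_def using b1 b2 b3 R(2) T(2) RR by auto
    have ne: "P @ [r] \<noteq> []" "r' # Q \<noteq> []" by auto
    obtain u where u: "u \<in> set (leg_words I i)" "realizes (rev (P @ [r])) u"
      using legL[of "P @ [r]" "hd M" "tl M @ r' # Q"] RR Mne by auto
    obtain v where v: "v \<in> set (leg_words I j)" "realizes (r' # Q) v"
      using legR[of "P @ [r] @ butlast M" "last M" "r' # Q"] RR Mne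
      by (metis append.assoc append_Cons append_Nil append_butlast_last_id ne snoc_eq_iff_butlast Nil_is_append_conv)
    show False
    proof (cases "labels [t] = {}")
      case True
      then obtain w where w: "w \<in> set (tail_words nb m)" "realizes T w" using w0 by auto
      then show False
        using tripod_refuted_sound[OF Z tri u(2) v(2) w(2), where C="[]"] okt(3)[OF w(1) u(1) v(1)] True by auto
    next
      case False
      then obtain q where q: "labels [t] = {q}" using tlab by auto
      obtain w where w: "w \<in> set (if q = m then [[]] else tail_words nb m)" "realizes T w" using wq[OF q] by blast
      then show False
        using tripod_refuted_sound[OF Z tri u(2) v(2) w(2), where C="[q]"] okq(1)[OF w(1) u(1) v(1)] q by auto
    qed
  qed
qed

end

context odd_base begin

section \<open>Exploring the outside of a base\<close>

text \<open>
  The first entry describes R itself, the others describe ears contained in R.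
\<close>

definition holds :: "'l earc list \<Rightarrow> 'a list \<Rightarrow> bool" where
  "holds g R \<longleftrightarrow> (case g of [] \<Rightarrow> False | (i, j, I) # h \<Rightarrow> ear R i j (set I) \<and>
     (\<forall>(a, c, A)\<in>set h. \<exists>S. ear S a c (set A) \<and> set S \<subseteq> set R))"

lemma suffix_ear:
  assumes "ipath E (P1 @ w # P2 @ [y])" "set (P1 @ w # P2 @ [y]) \<subseteq> Out" "E w (b i)" "E y (b j)"
  shows "ear (w # P2 @ [y]) i j (labels P2)"
  using assms ipath_appendD[of E P1 "w # P2 @ [y]"] by (intro earI) auto

text \<open>
  Cut the path at the first vertex y where the labels stop being confined to m and one of its neighbours.
\<close>

lemma ear_on_path:
  assumes "ipath E P" "set P \<subseteq> Out" "P \<noteq> []" "E (hd P) (b m)" "nb m \<noteq> []"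
    "\<And>x. x \<in> set (nb m) \<Longrightarrow> \<not> labels P \<subseteq> {m, x}"
  shows "\<exists>h\<in>set (outcomes nb us m). \<exists>R. holds h R \<and> set R \<subseteq> set P"
  using assms
proof (induction P rule: rev_induct)
  case (snoc y Q)
  show ?case
  proof (cases "Q \<noteq> [] \<and> (\<forall>x\<in>set (nb m). \<not> labels Q \<subseteq> {m, x})")
    case True
    then have "\<exists>h\<in>set (outcomes nb us m). \<exists>R. holds h R \<and> set R \<subseteq> set Q"
      using snoc ipath_appendD[of E Q "[y]"] by (intro snoc.IH) auto
    then show ?thesis by fastforce
  next
    case F: False
    have Qne: "Q \<noteq> []"
    proof
      assume "Q = []"
      moreover obtain x where "x \<in> set (nb m)" using snoc.prems(5) by (cases "nb m") auto
      ultimately show False using snoc.prems(2,4) snoc.prems(6)[of x] label_set[of y m] by auto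
    qed
    then obtain x where x: "x \<in> set (nb m)" "labels Q \<subseteq> {m, x}" using F by auto
    have xm: "x \<noteq> m" using x(1) adj_irr by auto
    have "\<not> labels [y] \<subseteq> {m, x}" using snoc.prems(6)[OF x(1)] x(2) by auto
    then obtain q where q: "E y (b q)" "q \<noteq> m" "q \<noteq> x" by auto
    have qs: "q \<in> set us" using us by simp
    have mQ: "m \<in> labels Q" using Qne snoc.prems(4) by (auto simp: labels_mem)
    show ?thesis
    proof (cases "q \<in> set (nb m)")
      case False
      obtain Q1 w Q2 where s: "Q = Q1 @ w # Q2" "E w (b m)" "m \<notin> labels Q2" using last_label_eq[OF mQ] by blast
      have e: "ear (w # Q2 @ [y]) m q (labels Q2)"
        using snoc.prems(1,2) s q by (intro suffix_ear[of Q1]) auto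
      have Q2x: "labels Q2 \<subseteq> {x}" using x(2) s by auto
      show ?thesis
      proof (cases "labels Q2 = {}")
        case True
        then have "holds [(m, q, [])] (w # Q2 @ [y])" using e by (simp add: holds_def)
        then show ?thesis using outcomes_clean[where nb = nb, OF qs q(2) False] s(1) by (intro bexI[of _ "[(m, q, [])]"] exI) auto
      next
        case nF: False
        then have Q2: "labels Q2 = {x}" using Q2x by auto
        then have xQ2: "x \<in> labels Q2" by simp
        obtain A v B where s2: "Q2 = A @ v # B" "E v (b x)" "x \<notin> labels B" using last_label_eq[OF xQ2] by blast
        have "labels B = {}" using Q2 s2 by auto
        moreover have "ear (v # B @ [y]) x q (labels B)"
          using snoc.prems(1,2) s s2 q by (intro suffix_ear[of "Q1 @ w # A"]) auto
        ultimately have "holds (if q \<in> set (nb x) then [(m, q, [x])] else [(m, q, [x]), (x, q, [])]) (w # Q2 @ [y])"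
          using e Q2 s2 by (auto simp: holds_def intro!: exI[of _ "v # B @ [y]"])
        then show ?thesis using outcomes_far[where nb = nb, OF qs q(2) False x(1)] s(1)
          by (intro bexI exI conjI) auto
      qed
    next
      case True
      have "x \<in> labels Q"
      proof (rule ccontr)
        assume "x \<notin> labels Q"
        then have "labels (Q @ [y]) \<subseteq> {m, q}" using x(2) label_set[of y q] q snoc.prems(2) by auto
        then show False using snoc.prems(6)[OF True] by blast
      qed
      then obtain Q1 w Q2 where s: "Q = Q1 @ w # Q2" "E w (b x)" "x \<notin> labels Q2" using last_label_eq by blast
      have e: "ear (w # Q2 @ [y]) x q (labels Q2)"
        using snoc.prems(1,2) s q by (intro suffix_ear[of Q1]) auto
      have Q2m: "labels Q2 \<subseteq> {m}" using x(2) s by auto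
      obtain I where "holds [(x, q, I)] (w # Q2 @ [y])" "I = [] \<or> I = [m]"
      proof (cases "labels Q2 = {}")
        case True
        then show ?thesis using that[of "[]"] e by (auto simp: holds_def)
      next
        case False
        then have "labels Q2 = {m}" using Q2m by auto
        then show ?thesis using that[of "[m]"] e by (auto simp: holds_def)
      qed
      then show ?thesis using outcomes_near[where nb = nb, OF x(1) True] q(3) s(1) by (intro bexI[of _ "[(x, q, I)]"] exI) auto
    qed
  qed
qed simp

text \<open>
  Walk away from w, which is labelled m, outside the base. W is the union of the ears found so far. Either the
  walk comes into contact with W before its labels leave m and one neighbour of m, which is the second
  alternative, or an ear that is anticomplete to W is found. For this the assumption is needed that some label
  besides m and x can be reached: otherwise the walk could be trapped in a component whose labels are m and x
  only.
\<close>

lemma explore: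
  assumes spread: "\<And>x. x \<in> set (nb m) \<Longrightarrow> \<exists>v k. reach E Out w v \<and> E v (b k) \<and> k \<noteq> m \<and> k \<noteq> x"
    and w: "w \<in> Out" "w \<notin> W" "E w (b m)" and ne: "nb m \<noteq> []"
  shows "(\<exists>h\<in>set (outcomes nb us m). \<exists>R. holds h R \<and> anticomplete (set R) W) \<or>
     (\<exists>t T x. ipath E (t # T) \<and> set (t # T) \<subseteq> Out \<and> t \<notin> W \<and> (\<exists>r\<in>W. E t r) \<and>
        (\<forall>y\<in>set T. y \<notin> W \<and> (\<forall>r\<in>W. \<not> E y r)) \<and> E (last (t # T)) (b m) \<and> labels T \<subseteq> {m, x} \<and> x \<in> set (nb m))"
proof (cases "\<exists>v. reach E Out w v \<and> (v \<in> W \<or> (\<exists>r\<in>W. E v r))")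
  case True
  then obtain v where v: "reach E Out w v" "v \<in> W \<or> (\<exists>r\<in>W. E v r)" by blast
  obtain p where p: "p \<noteq> []" "ipath E p" "hd p = w" "last p = v" "set p \<subseteq> Out"
    using reach_ipath[OF v(1) w(1)] by blast
  have "v \<in> set p" using last_in_set[OF p(1)] p(4) by simp
  then have "\<exists>y\<in>set p. y \<in> W \<or> (\<exists>r\<in>W. E y r)" using v(2) by blast
  from split_list_first_prop[OF this] obtain p1 y p2 where s: "p = p1 @ y # p2"
      "y \<in> W \<or> (\<exists>r\<in>W. E y r)" "\<forall>z\<in>set p1. \<not> (z \<in> W \<or> (\<exists>r\<in>W. E z r))" by blast
  have ip: "ipath E (p1 @ [y])" using p(2) s(1) ipath_appendD[of E "p1 @ [y]" p2] by simp
  have yW: "y \<notin> W"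
  proof (cases "p1 = []")
    case True
    then show ?thesis using p(3) s(1) w(2) by simp
  next
    case False
    then have "E (last p1) y" using ip ipath_append[of p1 "[y]" E] by auto
    then show ?thesis using s(3) last_in_set[OF False] by blast
  qed
  show ?thesis
  proof (cases "\<exists>x\<in>set (nb m). labels p1 \<subseteq> {m, x}")
    case True
    then obtain x where x: "x \<in> set (nb m)" "labels p1 \<subseteq> {m, x}" by blast
    have "last (y # rev p1) = w" using p(1,3) s(1) by (cases p1) auto
    moreover have "ipath E (y # rev p1)" using ipath_revI[OF ip] by simp
    ultimately show ?thesis using x s yW w(3) p(5)
      by (intro disjI2 exI[of _ y] exI[of _ "rev p1"] exI[of _ x]) auto
  next
    case False
    have p1: "p1 \<noteq> []"
    proof
      assume "p1 = []"
      then show False using False ne by (cases "nb m") auto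
    qed
    have "\<exists>h\<in>set (outcomes nb us m). \<exists>R. holds h R \<and> set R \<subseteq> set p1"
      using False p1 ip ipath_appendD[of E p1 "[y]"] p s(1) w(3) ne by (intro ear_on_path) auto
    moreover have "anticomplete (set p1) W" using s(3) by (auto simp: anticomplete_def)
    ultimately show ?thesis using anticomplete_mono by blast
  qed
next
  case F: False
  have far: "anticomplete (set p) W" if p: "p \<noteq> []" "ipath E p" "reach E Out w (hd p)" "set p \<subseteq> Out" for p
  proof -
    have "reach E Out w y" if y: "y \<in> set p" for y
    proof -
      obtain p1 p2 where s: "p = p1 @ y # p2" using y by (auto dest: split_list)
      then have "ipath E (p1 @ [y])" using p(2) ipath_appendD[of E "p1 @ [y]" p2] by simp
      then have "reach E Out (hd (p1 @ [y])) (last (p1 @ [y]))"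
        using p(4) s by (intro walk_reach ipath_successively) auto
      moreover have "hd (p1 @ [y]) = hd p" using s by (cases p1) auto
      ultimately show ?thesis using reach_trans[OF p(3)] by simp
    qed
    then show ?thesis using F by (fastforce simp: anticomplete_def)
  qed
  show ?thesis
  proof (cases "\<exists>v k. reach E Out w v \<and> E v (b k) \<and> k \<noteq> m \<and> k \<notin> set (nb m)")
    case True
    then obtain v k where v: "reach E Out w v" "E v (b k)" "k \<noteq> m" "k \<notin> set (nb m)" by blast
    obtain p where p: "p \<noteq> []" "ipath E p" "hd p = w" "last p = v" "set p \<subseteq> Out"
      using reach_ipath[OF v(1) w(1)] by blast
    have "k \<in> labels p" using p v by (auto simp: labels_mem)
    then have "\<exists>h\<in>set (outcomes nb us m). \<exists>R. holds h R \<and> set R \<subseteq> set p"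
      using p w(3) ne v by (intro ear_on_path) auto
    moreover have "anticomplete (set p) W" using p by (intro far) (auto simp: reach_def)
    ultimately show ?thesis using anticomplete_mono by blast
  next
    case False
    then have near: "k \<in> set (nb m)" if "reach E Out w v" "E v (b k)" "k \<noteq> m" for v k using that by blast
    \<comment> \<open>Only m and its neighbours occur as labels around w, but two distinct neighbours of m do.\<close>
    obtain x0 where "x0 \<in> set (nb m)" using ne by (cases "nb m") auto
    then obtain v1 k1 where v1: "reach E Out w v1" "E v1 (b k1)" "k1 \<noteq> m" using spread by blast
    have k1: "k1 \<in> set (nb m)" using near v1 by blast
    obtain v2 k2 where v2: "reach E Out w v2" "E v2 (b k2)" "k2 \<noteq> m" "k2 \<noteq> k1" using spread[OF k1] by blast
    have k2: "k2 \<in> set (nb m)" using near v2 by blast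
    have o: "v1 \<in> Out" "v2 \<in> Out" using reach_mem[OF v1(1) w(1)] reach_mem[OF v2(1) w(1)] by auto
    have "reach E Out v1 w" by (rule reach_sym[of E, OF sym v1(1)])
    then have "reach E Out v1 v2" by (rule reach_trans[OF _ v2(1)])
    then obtain p where p: "p \<noteq> []" "ipath E p" "hd p = v1" "last p = v2" "set p \<subseteq> Out"
      using reach_ipath[OF _ o(1)] by blast
    have v2p: "v2 \<in> set p" using last_in_set[OF p(1)] p(4) by simp
    have a: "anticomplete (set p) W" using p v1 by (intro far) auto
    have "\<exists>y\<in>set p. \<exists>k. k \<noteq> m \<and> k \<noteq> k1 \<and> E y (b k)" using v2p v2 by blast
    from split_list_first_prop[OF this] obtain p1 y p2 k where s: "p = p1 @ y # p2" "k \<noteq> m" "k \<noteq> k1" "E y (b k)"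
      "\<forall>z\<in>set p1. \<not> (\<exists>k. k \<noteq> m \<and> k \<noteq> k1 \<and> E z (b k))" by blast
    have "p1 \<noteq> []"
    proof
      assume "p1 = []"
      then have "y = v1" using s(1) p(3) by simp
      then show False using one_label[OF o(1) v1(2)] s by blast
    qed
    then have "k1 \<in> labels p1" using p(3) s(1) v1(2) by (auto simp: labels_mem)
    then obtain A z B where s2: "p1 = A @ z # B" "E z (b k1)" "k1 \<notin> labels B" using last_label_eq by blast
    have B: "labels B \<subseteq> {m}"
    proof
      fix j assume j: "j \<in> labels B"
      then obtain c where "c \<in> set B" "E c (b j)" by (auto simp: labels_mem)
      then show "j \<in> {m}" using s(5) s2 j by auto
    qed
    have "reach E Out v1 y"
    proof -
      have "ipath E (p1 @ [y])" using p(2) s(1) ipath_appendD[of E "p1 @ [y]" p2] by simp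
      then have "reach E Out (hd (p1 @ [y])) (last (p1 @ [y]))"
        using p(5) s by (intro walk_reach ipath_successively) auto
      moreover have "hd (p1 @ [y]) = v1" using s p(3) by (cases p1) auto
      ultimately show ?thesis by simp
    qed
    then have k: "k \<in> set (nb m)" using near[of y k] reach_trans[OF v1(1)] s by blast
    have e: "ear (z # B @ [y]) k1 k (labels B)"
    proof (rule suffix_ear[of A])
      show "ipath E (A @ z # B @ [y])" using p(2) s(1) s2(1) ipath_appendD[of E "p1 @ [y]" p2] by simp
    qed (use p(5) s s2 in auto)
    obtain I where I: "holds [(k1, k, I)] (z # B @ [y])" "I = [] \<or> I = [m]"
    proof (cases "labels B = {}")
      case True
      then show ?thesis using that[of "[]"] e by (auto simp: holds_def)
    next
      case False
      then have "labels B = {m}" using B by auto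
      then show ?thesis using that[of "[m]"] e by (auto simp: holds_def)
    qed
    have "anticomplete (set (z # B @ [y])) W" using s(1) s2(1) by (intro anticomplete_mono[OF a]) auto
    then show ?thesis using I outcomes_near[where nb = nb, OF k1 k] s(3) by (intro disjI1 bexI[of _ "[(k1, k, I)]"] exI) auto
  qed
qed

lemma clash_sound:
  assumes "holds g R" "holds h S" "anticomplete (set R) (set S)" "clash nb us X g h"
  shows False
proof -
  have sub: "\<exists>R'. ear R' i j (set I) \<and> set R' \<subseteq> set R" if "holds g R" "(i, j, I) \<in> set g" for g R i j I
    using that by (cases g) (auto simp: holds_def)
  obtain i j I s t J where c: "(i, j, I) \<in> set g" "(s, t, J) \<in> set h" "two_ears_refuted nb us X (i, j, I) (s, t, J)"
    using assms(4) unfolding clash_def by (metis prod_cases3)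
  obtain R' where R': "ear R' i j (set I)" "set R' \<subseteq> set R" using sub[OF assms(1) c(1)] by blast
  obtain S' where S': "ear S' s t (set J)" "set S' \<subseteq> set S" using sub[OF assms(2) c(2)] by blast
  show False using two_ears_refuted_sound[OF R'(1) S'(1) _ c(3)] anticomplete_mono[OF assms(3) R'(2) S'(2)] by blast
qed

text \<open>
  Induction over the rounds, keeping an ear of the graph for every entry of gs. Exploring from m then realizes
  one of the outcomes that the game has an answer to.
\<close>

theorem refuted_sound:
  assumes Z: "\<And>i j R. (i, j) \<in> set Z \<Longrightarrow> \<not> ear R i j {}"
    and start: "\<And>M m. M \<in> set Ms \<Longrightarrow> m \<in> set M \<Longrightarrow> \<exists>w\<in>Out. E w (b m)"
    and spread: "\<And>w m x. w \<in> Out \<Longrightarrow> x \<in> set (nb m) \<Longrightarrow> \<exists>v k. reach E Out w v \<and> E v (b k) \<and> k \<noteq> m \<and> k \<noteq> x"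
    and "\<And>g. g \<in> set gs \<Longrightarrow> \<exists>R. holds g R" "refuted nb us X Z Ms gs"
  shows False
  using assms(2,4,5)
proof (induction Ms arbitrary: gs)
  case (Cons M Ms)
  obtain m where m: "m \<in> set M" "nb m \<noteq> []" "\<And>g. g \<in> set gs \<Longrightarrow> touch_refuted nb us X Z (hd g) m"
    "\<And>h. h \<in> set (outcomes nb us m) \<Longrightarrow> excluded Z h \<or> (\<exists>g\<in>set gs. clash nb us X g h) \<or> refuted nb us X Z Ms (h # gs)"
    using Cons.prems(3) by auto
  obtain f where f: "\<And>g. g \<in> set gs \<Longrightarrow> holds g (f g)" using Cons.prems(2) by metis
  obtain w where w: "w \<in> Out" "E w (b m)" using Cons.prems(1)[of M m] m(1) by auto
  define W where "W = (\<Union>g\<in>set gs. set (f g))"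
  \<comment> \<open>Only the main ear of each group matters for touching; the smaller ones lie inside it.\<close>
  have main: "\<exists>i j I h. g = (i, j, I) # h \<and> ear (f g) i j (set I) \<and> touch_refuted nb us X Z (i, j, I) m" if "g \<in> set gs" for g
    using f[OF that] m(3)[OF that] by (cases g) (fastforce simp: holds_def)+
  have wW: "w \<notin> W"
  proof
    assume "w \<in> W"
    then obtain g where g: "g \<in> set gs" "w \<in> set (f g)" by (auto simp: W_def)
    then obtain i j I where e: "ear (f g) i j (set I)" "touch_refuted nb us X Z (i, j, I) m" using main by blast
    then have "m \<noteq> i" "m \<noteq> j" "m \<notin> set I" by auto
    then show False using ear_cross[OF e(1) g(2), of m] w(2) by auto
  qed
  from explore[OF spread[OF w(1)] w(1) wW w(2) m(2)]
  consider (new) h R where "h \<in> set (outcomes nb us m)" "holds h R" "anticomplete (set R) W"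
    | (touch) t T x where "ipath E (t # T)" "set (t # T) \<subseteq> Out" "t \<notin> W" "\<exists>r\<in>W. E t r"
        "\<forall>y\<in>set T. y \<notin> W \<and> (\<forall>r\<in>W. \<not> E y r)" "E (last (t # T)) (b m)" "labels T \<subseteq> {m, x}" "x \<in> set (nb m)"
    by blast
  then show False
  proof cases
    case touch
    obtain g where g: "g \<in> set gs" "\<exists>r\<in>set (f g). E t r" using touch(4) by (auto simp: W_def)
    have sub: "set (f g) \<subseteq> W" using g by (auto simp: W_def)
    obtain i j I where e: "ear (f g) i j (set I)" "touch_refuted nb us X Z (i, j, I) m" using main g(1) by blast
    show False
      using touch sub g by (intro touch_sound[OF Z e touch(1,2) _ g(2) _ touch(6-8)]) auto
  next
    case new
    then consider "excluded Z h" | g where "g \<in> set gs" "clash nb us X g h" | "refuted nb us X Z Ms (h # gs)"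
      using m(4)[OF new(1)] by auto
    then show False
    proof cases
      case 1
      then obtain i j where ij: "(i, j, []) \<in> set h" "among Z i j" by (auto simp: excluded_def)
      obtain S where "ear S i j {}" using new(2) ij(1) by (cases h) (auto simp: holds_def)
      then show False using Z[of i j S] Z[of j i "rev S"] ear_rev[of S i j "{}"] ij(2) unfolding among_def by blast
    next
      case 2
      have "anticomplete (set (f g)) (set R)" using new(3) 2(1) sym unfolding anticomplete_def W_def by blast
      then show False using clash_sound[OF f[OF 2(1)] new(2) _ 2(2)] by blast
    next
      case 3
      show False
      proof (rule Cons.IH[OF _ _ 3])
        show "\<exists>w\<in>Out. E w (b k)" if "N \<in> set Ms" "k \<in> set N" for N k
          using Cons.prems(1)[of N k] that by simp
        show "\<exists>R. holds k R" if "k \<in> set (h # gs)" for k using Cons.prems(2) new(2) that by auto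
      qed
    qed
  qed
qed simp

end

section \<open>Two bases: the octagon and the theta graph\<close>

fun ways :: "('l \<Rightarrow> 'l list) \<Rightarrow> 'k list \<Rightarrow> 'l \<Rightarrow> 'l list \<Rightarrow> 'l list list" where
  "ways nb [] j P = []"
| "ways nb (f # fs) j P = (if hd P = j then [P] else concat (map (\<lambda>x. ways nb fs j (x # P))
     (filter (\<lambda>x. x \<notin> set P \<and> (\<forall>y\<in>set (tl P). x \<notin> set (nb y))) (nb (hd P)))))"

definition two_ways :: "('l \<Rightarrow> 'l list) \<Rightarrow> 'l list \<Rightarrow> 'l \<Rightarrow> 'l \<Rightarrow> bool" where
  "two_ways nb us i j \<longleftrightarrow> (\<exists>K\<in>set (ways nb us i [j]). \<exists>L\<in>set (ways nb us i [j]).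
     length K \<noteq> length L \<and> ipath (\<lambda>x y. y \<in> set (nb x)) K \<and> ipath (\<lambda>x y. y \<in> set (nb x)) L)"

lemma ways_ends: "K \<in> set (ways nb fs i P) \<Longrightarrow> P \<noteq> [] \<Longrightarrow> K \<noteq> [] \<and> hd K = i \<and> last K = last P"
proof (induction fs arbitrary: P)
  case (Cons f fs)
  show ?case
  proof (cases "hd P = i")
    case True
    then show ?thesis using Cons.prems by simp
  next
    case False
    then obtain x where "K \<in> set (ways nb fs i (x # P))" using Cons.prems(1) by auto
    then show ?thesis using Cons.IH[of "x # P"] Cons.prems(2) by simp
  qed
qed simp

context base_graph begin

text \<open>
  An ear of the other parity would be closed to an even hole by both paths. Both holes would have length 8, but
  the two paths have different lengths.
\<close>

lemma two_ways_odd: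
  assumes "ear R i j {}" "two_ways nb us j i" shows "odd_type R i j"
proof (rule ccontr)
  assume n: "\<not> odd_type R i j"
  obtain K L where K: "K \<in> set (ways nb us j [i])" "L \<in> set (ways nb us j [i])" "length K \<noteq> length L"
    "ipath adj K" "ipath adj L" using assms(2) by (auto simp: two_ways_def)
  have "length R + length M = 8" if "M \<in> set (ways nb us j [i])" "ipath adj M" for M
  proof (rule ear_hole[OF assms(1) that(2)])
    show "even (length R + length M)"
      using col_path[OF ipath_successively[OF that(2)]] ways_ends[OF that(1)] n unfolding odd_type_def by auto
  qed (use ways_ends[OF that(1)] in auto)
  from this[OF K(1,4)] this[OF K(2,5)] show False using K(3) by simp
qed

end

datatype oct = C0 | C1 | C2 | C3 | C4 | C5 | C6 | C7

fun oct_nb :: "oct \<Rightarrow> oct list" where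
  "oct_nb C0 = [C1, C7]" | "oct_nb C1 = [C0, C2]" | "oct_nb C2 = [C1, C3]" | "oct_nb C3 = [C2, C4]"
| "oct_nb C4 = [C3, C5]" | "oct_nb C5 = [C4, C6]" | "oct_nb C6 = [C5, C7]" | "oct_nb C7 = [C6, C0]"

definition "octs = [C0, C1, C2, C3, C4, C5, C6, C7]"

fun oct_col :: "oct \<Rightarrow> bool" where
  "oct_col C0 = True" | "oct_col C1 = False" | "oct_col C2 = True" | "oct_col C3 = False"
| "oct_col C4 = True" | "oct_col C5 = False" | "oct_col C6 = True" | "oct_col C7 = False"

text \<open>
  An entry (i, j, m) asks to show that there is no clean ear from i to j by exploring from m. The pairs at
  distance at least 3 come first, since their exclusion is used for those at distance 2. The starting points and
  the order were found by a computer search.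
\<close>

definition "oct_far = [(C0,C3,C5), (C0,C4,C2), (C0,C5,C2), (C1,C4,C6), (C1,C5,C3), (C1,C6,C3),
  (C2,C5,C0), (C2,C6,C0), (C2,C7,C4), (C3,C6,C0), (C3,C7,C1), (C4,C7,C1)]"

definition "oct_mid = [(C0,C2,C5), (C0,C6,C3), (C1,C3,C6), (C1,C7,C4), (C2,C4,C7), (C3,C5,C0), (C4,C6,C1), (C5,C7,C2)]"

datatype theta = TU | TW | A1 | M1 | B1 | A2 | M2 | B2 | A3 | M3 | B3

text \<open>
  The theta graph: two hubs TU and TW, joined by three paths with inner vertices Ak, Mk, Bk.
\<close>

fun theta_nb :: "theta \<Rightarrow> theta list" where
  "theta_nb TU = [A1, A2, A3]" | "theta_nb TW = [B1, B2, B3]"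
| "theta_nb A1 = [TU, M1]" | "theta_nb M1 = [A1, B1]" | "theta_nb B1 = [TW, M1]"
| "theta_nb A2 = [TU, M2]" | "theta_nb M2 = [A2, B2]" | "theta_nb B2 = [TW, M2]"
| "theta_nb A3 = [TU, M3]" | "theta_nb M3 = [A3, B3]" | "theta_nb B3 = [TW, M3]"

definition "thetas = [TU, TW, A1, M1, B1, A2, M2, B2, A3, M3, B3]"

fun theta_col :: "theta \<Rightarrow> bool" where
  "theta_col TU = True" | "theta_col TW = True"
| "theta_col A1 = False" | "theta_col M1 = True" | "theta_col B1 = False"
| "theta_col A2 = False" | "theta_col M2 = True" | "theta_col B2 = False"
| "theta_col A3 = False" | "theta_col M3 = True" | "theta_col B3 = False"

text \<open>
  As for the octagon, but among the pairs at distance 2 only (Ak, Bk) needs to be excluded.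
\<close>

definition "theta_far = [(TU,B1,M2), (TU,B2,M1), (TU,B3,M1), (TW,A1,M2), (TW,A2,M1), (TW,A3,M1),
  (A1,M2,M3), (A1,B2,M3), (A1,M3,M2), (A1,B3,M2), (M1,A2,M3), (M1,M2,M3), (M1,B2,M3), (M1,A3,M2), (M1,M3,M2), (M1,B3,M2),
  (B1,A2,M3), (B1,M2,M3), (B1,A3,M2), (B1,M3,M2), (A2,M3,M1), (A2,B3,M1), (M2,A3,M1), (M2,M3,M1), (M2,B3,M1), (B2,A3,M1), (B2,M3,M1)]"

definition "theta_mid = [(A1,B1,M2), (A2,B2,M1), (A3,B3,M1)]"

definition pairs :: "('l \<times> 'l \<times> 'l) list \<Rightarrow> ('l \<times> 'l) list" where
  "pairs P = map (\<lambda>(i, j, m). (i, j)) P"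

definition refutes where
  "refutes nb us X Z P \<longleftrightarrow> (\<forall>(i, j, m)\<in>set P. refuted nb us X Z [[m]] [[(i, j, [])]])"

text \<open>
  The refutations are carried out by rewriting. A clean ear between the hubs of a theta graph is not known to
  have odd type, because the hubs are joined in the base only by paths of length 4.
\<close>

lemma oct_far: "refutes oct_nb octs [] [] oct_far" by code_simp

lemma oct_mid: "refutes oct_nb octs [] (pairs oct_far) oct_mid" by code_simp

lemma oct_final: "refuted oct_nb octs [] (pairs oct_far @ pairs oct_mid) [[C0], [C4]] []" by code_simp

lemma theta_far: "refutes theta_nb thetas [(TU, TW)] [] theta_far" by code_simp

lemma theta_mid: "refutes theta_nb thetas [(TU, TW)] (pairs theta_far) theta_mid" by code_simp

lemma theta_final: "refuted theta_nb thetas [(TU, TW)] (pairs theta_far @ pairs theta_mid)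
    [[M1], [M2, M3], [M2, M3]] []" by code_simp

text \<open>
  Two vertices of a base that are distinct and not adjacent are joined by induced paths of two different
  lengths, unless they are antipodal in the octagon or the hubs of the theta graph.
\<close>

lemma oct_ways: "\<forall>i\<in>set octs. \<forall>j\<in>set octs. i = j \<or> j \<in> set (oct_nb i) \<or> capped_dist oct_nb i j = 4 \<or> two_ways oct_nb octs i j"
  by code_simp

lemma theta_ways: "\<forall>i\<in>set thetas. \<forall>j\<in>set thetas. i = j \<or> j \<in> set (theta_nb i) \<or> among [(TU, TW)] i j \<or> two_ways theta_nb thetas i j"
  by code_simp

section \<open>Excluding both bases\<close>

text \<open>
  A vertex with two neighbours in the base has a third neighbour, which lies outside as the base is induced.
\<close>

lemma (in base_graph) outer_neighbour:
  assumes "length (nb m) = 2" "\<And>v x y. v \<in> V \<Longrightarrow> \<exists>w. E v w \<and> w \<noteq> x \<and> w \<noteq> y"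
  shows "\<exists>w\<in>Out. E w (b m)"
proof -
  obtain p q where n: "nb m = [p, q]" using assms(1) by (auto simp: length_Suc_conv numeral_2_eq_2)
  obtain w where w: "E (b m) w" "w \<noteq> b p" "w \<noteq> b q" using assms(2)[OF bV] by blast
  have "w \<noteq> b k" for k using w bE[of m k] n by auto
  then have "w \<in> Out" using EV[OF sym[OF w(1)]] by (auto simp: Out_def)
  then show ?thesis using sym[OF w(1)] by blast
qed

text \<open>
  Deleting the adjacent base vertices named m and x leaves the graph connected. A path from w to any other base
  vertex first meets the base in a vertex named neither m nor x.
\<close>

lemma (in base_graph) spread:
  assumes conn: "\<And>x y u w. E x y \<Longrightarrow> u \<in> V - {x, y} \<Longrightarrow> w \<in> V - {x, y} \<Longrightarrow> reach E (V - {x, y}) u w"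
    and w: "w \<in> Out" and x: "x \<in> set (nb m)" and k: "k \<noteq> m" "k \<noteq> x"
  shows "\<exists>v k. reach E Out w v \<and> E v (b k) \<and> k \<noteq> m \<and> k \<noteq> x"
proof -
  let ?S = "V - {b m, b x}"
  have wS: "w \<in> ?S" using w by (auto simp: Out_def)
  have kS: "b k \<in> ?S" using k bV inj by (auto simp: inj_eq)
  have "E (b m) (b x)" using x bE by simp
  then have "reach E ?S w (b k)" using conn[OF _ wS kS] by blast
  from reach_ipath[OF this wS] obtain p where p: "p \<noteq> []" "ipath E p" "hd p = w" "last p = b k" "set p \<subseteq> ?S"
    by blast
  have "b k \<in> set p" using p(1,4) last_in_set by metis
  then have "\<exists>y\<in>set p. y \<in> range b" by blast
  from split_list_first_prop[OF this] obtain p1 y p2 where s: "p = p1 @ y # p2" "y \<in> range b"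
      "\<forall>z\<in>set p1. z \<notin> range b" by blast
  obtain l where l: "y = b l" using s(2) by auto
  have ne: "p1 \<noteq> []" using s p(3) w by (auto simp: Out_def)
  have ip: "ipath E (p1 @ [y])" using p(2) s(1) ipath_appendD[of E "p1 @ [y]" p2] by simp
  have "set p1 \<subseteq> Out" using s p(5) by (auto simp: Out_def)
  then have "reach E Out (hd p1) (last p1)"
    using ip ne ipath_appendD[of E p1 "[y]"] by (intro walk_reach ipath_successively) auto
  moreover have "hd p1 = w" using s(1) p(3) ne by simp
  moreover have "E (last p1) (b l)" using ip ne l ipath_append[of p1 "[y]" E] by auto
  moreover have "l \<noteq> m" "l \<noteq> x" using p(5) s(1) l by auto
  ultimately show ?thesis by blast
qed

lemma (in odd_base) refutes_sound:
  assumes Z: "\<And>i j R. (i, j) \<in> set Z \<Longrightarrow> \<not> ear R i j {}"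
    and start: "\<And>m. length (nb m) = 2 \<Longrightarrow> \<exists>w\<in>Out. E w (b m)"
    and spread: "\<And>w m x. w \<in> Out \<Longrightarrow> x \<in> set (nb m) \<Longrightarrow> \<exists>v k. reach E Out w v \<and> E v (b k) \<and> k \<noteq> m \<and> k \<noteq> x"
    and P: "refutes nb us X Z P" "\<forall>(i, j, m)\<in>set P. length (nb m) = 2" and ij: "(i, j) \<in> set (pairs P)"
  shows "\<not> ear R i j {}"
proof
  assume e: "ear R i j {}"
  obtain m where m: "(i, j, m) \<in> set P" using ij by (auto simp: pairs_def)
  then have "refuted nb us X Z [[m]] [[(i, j, [])]]" using P(1) unfolding refutes_def by fast
  then show False
  proof (rule refuted_sound[OF Z _ spread, rotated -1])
    show "\<exists>w\<in>Out. E w (b n)" if "M \<in> set [[m]]" "n \<in> set M" for M n using that m P(2) start by auto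
    show "\<exists>R. holds g R" if "g \<in> set [[(i, j, [])]]" for g using that e by (auto simp: holds_def)
  qed
qed

text \<open>
  This is what the absence of vertices of degree 2 and of small clique cuts amounts to. The condition deg gives
  every vertex at least three neighbours.
\<close>

locale uncut = girth8 +
  assumes deg: "v \<in> V \<Longrightarrow> \<exists>w. E v w \<and> w \<noteq> x \<and> w \<noteq> y"
    and conn: "E x y \<Longrightarrow> u \<in> V - {x, y} \<Longrightarrow> w \<in> V - {x, y} \<Longrightarrow> reach E (V - {x, y}) u w"
begin

text \<open>
  By two paths of different lengths, clean ears whose end labels are distinct and not adjacent have odd type,
  except between the hubs. The game is then won in at most three rounds.
\<close>

theorem no_theta:
  fixes b :: "theta \<Rightarrow> 'a"
  assumes b: "inj b" "\<And>i j. E (b i) (b j) \<longleftrightarrow> j \<in> set (theta_nb i)"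
  shows False
proof -
  have usU: "set thetas = UNIV"
  proof -
    have "i \<in> set thetas" for i by (cases i) (auto simp: thetas_def)
    then show ?thesis by auto
  qed
  interpret base_graph V E b theta_nb theta_col
  proof
    show "inj b" by fact
    show "E (b i) (b j) \<longleftrightarrow> j \<in> set (theta_nb i)" for i j by (rule b(2))
    have "theta_nb i \<noteq> []" for i by (cases i) auto
    then show "b i \<in> V" for i using b(2)[of i "hd (theta_nb i)"] EV by simp
    show "theta_col i \<noteq> theta_col j" if "j \<in> set (theta_nb i)" for i j using that by (cases i) auto
    have "\<forall>i\<in>set thetas. \<forall>j\<in>set thetas. capped_dist theta_nb i j = 4 \<longrightarrow>
      (\<exists>x\<in>set (theta_nb i). \<exists>y\<in>set (theta_nb x). \<exists>z\<in>set (theta_nb y). j \<in> set (theta_nb z))" by code_simp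
    then show "\<exists>x\<in>set (theta_nb i). \<exists>y\<in>set (theta_nb x). \<exists>z\<in>set (theta_nb y). j \<in> set (theta_nb z)"
      if "capped_dist theta_nb i j = 4" for i j using that usU by auto
  qed
  interpret odd_base V E b theta_nb theta_col thetas "[(TU, TW)]"
  proof
    show "odd_type R i j" if "ear R i j {}" "i \<noteq> j" "\<not> adj i j" "\<not> among [(TU, TW)] i j" for R i j
    proof -
      have "j = i \<or> adj j i \<or> among [(TU, TW)] j i \<or> two_ways theta_nb thetas j i"
        using theta_ways usU by (metis UNIV_I)
      then have "two_ways theta_nb thetas j i"
        using that(2-4) adj_sym[of i j] unfolding among_def by metis
      then show ?thesis using two_ways_odd that by blast
    qed
  qed (rule usU)
  have start: "\<exists>w\<in>Out. E w (b m)" if "length (theta_nb m) = 2" for m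
    using outer_neighbour[OF that deg] by blast
  have sp: "\<exists>v k. reach E Out w v \<and> E v (b k) \<and> k \<noteq> m \<and> k \<noteq> x" if "w \<in> Out" "x \<in> set (theta_nb m)" for w m x
  proof -
    have "\<exists>k. k \<noteq> m \<and> k \<noteq> x" by (metis theta.distinct(1,3,5,21))
    then show ?thesis using spread[OF conn that] by blast
  qed
  have far: "\<not> ear R i j {}" if "(i, j) \<in> set (pairs theta_far)" for i j R
    by (rule refutes_sound[OF _ start sp theta_far _ that]) (auto simp: theta_far_def)
  have mid: "\<not> ear R i j {}" if "(i, j) \<in> set (pairs theta_mid)" for i j R
    by (rule refutes_sound[OF far start sp theta_mid _ that]) (auto simp: theta_mid_def)
  show False
  proof (rule refuted_sound[OF _ _ sp _ theta_final])
    show "\<not> ear R i j {}" if "(i, j) \<in> set (pairs theta_far @ pairs theta_mid)" for i j R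
      using that far mid by auto
    show "\<exists>w\<in>Out. E w (b m)" if "M \<in> set [[M1], [M2, M3], [M2, M3]]" "m \<in> set M" for M m
      using that by (intro start) auto
    show "\<exists>R. holds g R" if "g \<in> set []" for g using that by simp
  qed
qed

end

lemma odd_up_to_5: "odd n \<Longrightarrow> n \<noteq> 1 \<Longrightarrow> n \<noteq> 3 \<Longrightarrow> n \<le> 5 \<Longrightarrow> n = (5::nat)"
  by presburger

text \<open>
  Rotation of the octagon, by which an arbitrary antipodal pair is brought to the position C0, C4.
\<close>

fun spin :: "oct \<Rightarrow> oct" where
  "spin C0 = C1" | "spin C1 = C2" | "spin C2 = C3" | "spin C3 = C4"
| "spin C4 = C5" | "spin C5 = C6" | "spin C6 = C7" | "spin C7 = C0"

lemma spin_pow: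
  "inj (spin ^^ k)" "(spin ^^ k) j \<in> set (oct_nb ((spin ^^ k) i)) \<longleftrightarrow> j \<in> set (oct_nb i)"
proof (induction k)
  case (Suc k)
  have s: "spin j \<in> set (oct_nb (spin i)) \<longleftrightarrow> j \<in> set (oct_nb i)" for i j by (cases i; cases j) auto
  have "spin i = spin j \<Longrightarrow> i = j" for i j by (cases i; cases j) auto
  then have "inj spin" by (auto simp: inj_def)
  {
    case 1 show ?case using inj_compose[OF \<open>inj spin\<close> Suc(1)] by (simp only: funpow.simps)
  next
    case 2 show ?case using Suc(2) s by simp
  }
qed auto

lemma spin_onto: "capped_dist oct_nb i j = 4 \<Longrightarrow> \<exists>k. (spin ^^ k) C0 = i \<and> (spin ^^ k) C4 = j"
proof -
  assume d: "capped_dist oct_nb i j = 4"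
  have "\<exists>k. (spin ^^ k) C0 = i"
  proof (cases i)
    case C0 then show ?thesis by (intro exI[of _ 0]) simp
  next
    case C1 then show ?thesis by (intro exI[of _ 1]) simp
  next
    case C2 then show ?thesis by (intro exI[of _ 2]) (simp add: eval_nat_numeral)
  next
    case C3 then show ?thesis by (intro exI[of _ 3]) (simp add: eval_nat_numeral)
  next
    case C4 then show ?thesis by (intro exI[of _ 4]) (simp add: eval_nat_numeral)
  next
    case C5 then show ?thesis by (intro exI[of _ 5]) (simp add: eval_nat_numeral)
  next
    case C6 then show ?thesis by (intro exI[of _ 6]) (simp add: eval_nat_numeral)
  next
    case C7 then show ?thesis by (intro exI[of _ 7]) (simp add: eval_nat_numeral)
  qed
  moreover have "(spin ^^ k) C4 = spin (spin (spin (spin ((spin ^^ k) C0))))" for k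
    by (induction k) auto
  moreover have "j = spin (spin (spin (spin i)))" using d by (cases i; cases j) (auto simp: capped_dist_def)
  ultimately show ?thesis by metis
qed

context uncut begin

text \<open>
  Where a clean ear between antipodal vertices has the wrong parity, it closes to holes of length 8 with both
  halves of the octagon, and the octagon together with the ear is a theta graph. Thus clean ears have odd type,
  without exceptions, and the game can be played.
\<close>

theorem no_octagon:
  fixes b :: "oct \<Rightarrow> 'a"
  assumes b: "inj b" "\<And>i j. E (b i) (b j) \<longleftrightarrow> j \<in> set (oct_nb i)"
  shows False
proof -
  have usU: "set octs = UNIV"
  proof -
    have "i \<in> set octs" for i by (cases i) (auto simp: octs_def)
    then show ?thesis by auto
  qed
  interpret base_graph V E b oct_nb oct_col
  proof
    show "inj b" by fact
    show "E (b i) (b j) \<longleftrightarrow> j \<in> set (oct_nb i)" for i j by (rule b(2))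
    have "oct_nb i \<noteq> []" for i by (cases i) auto
    then show "b i \<in> V" for i using b(2)[of i "hd (oct_nb i)"] EV by simp
    show "oct_col i \<noteq> oct_col j" if "j \<in> set (oct_nb i)" for i j using that by (cases i) auto
    have "\<forall>i\<in>set octs. \<forall>j\<in>set octs. capped_dist oct_nb i j = 4 \<longrightarrow>
      (\<exists>x\<in>set (oct_nb i). \<exists>y\<in>set (oct_nb x). \<exists>z\<in>set (oct_nb y). j \<in> set (oct_nb z))" by code_simp
    then show "\<exists>x\<in>set (oct_nb i). \<exists>y\<in>set (oct_nb x). \<exists>z\<in>set (oct_nb y). j \<in> set (oct_nb z)"
      if "capped_dist oct_nb i j = 4" for i j using that usU by auto
  qed
  have antipodal: "odd_type R i j" if e: "ear R i j {}" and d: "capped_dist oct_nb i j = 4" for R i j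
  proof (rule ccontr)
    assume n: "\<not> odd_type R i j"
    obtain K where K: "K \<noteq> []" "ipath adj K" "hd K = j" "last K = i" "length K \<le> capped_dist oct_nb j i + 1"
      using geodesic by blast
    \<comment> \<open>A geodesic K has five vertices, so that the ear has three.\<close>
    have K8: "length R + length K = 8"
      using col_path[OF ipath_successively[OF K(2)] K(1)] K n e
      by (intro ear_hole[OF e K(2,1,3,4)]) (auto simp: odd_type_def)
    obtain k where k: "(spin ^^ k) C0 = i" "(spin ^^ k) C4 = j" using spin_onto[OF d] by blast
    define g where "g = b \<circ> (spin ^^ k)"
    have gE: "E (g x) (g y) \<longleftrightarrow> y \<in> set (oct_nb x)" for x y using b(2) spin_pow(2) by (simp add: g_def)
    have gi: "inj g" unfolding g_def by (rule inj_compose[OF b(1) spin_pow(1)])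
    have "length K = 5"
    proof -
      have "oct_col i = oct_col j" using d by (cases i; cases j) (auto simp: capped_dist_def)
      then have "odd (length K)"
        using col_path[OF ipath_successively[OF K(2)] K(1)] K by simp
      moreover have "length K \<noteq> 1"
      proof
        assume "length K = 1"
        then have "hd K = last K" by (cases K) auto
        then show False using K d by (auto simp: capped_dist_def)
      qed
      moreover have "length K \<noteq> 3"
      proof
        assume "length K = 3"
        then obtain x y z where xyz: "K = [x, y, z]" by (auto simp: numeral_3_eq_3 length_Suc_conv)
        then have "adj z y" "adj y x" using K(2) adj_sym by auto
        then show False using K xyz d by (auto simp: capped_dist_def split: if_splits)
      qed
      moreover have "length K \<noteq> 0" "length K \<le> 5" using K(1,5) capped_dist_le[of j i] by simp_all
      ultimately show ?thesis
        using odd_up_to_5 by blast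
    qed
    then obtain x y z where R: "R = [x, y, z]" using K8 by (auto simp: length_Suc_conv eval_nat_numeral)
    have ip: "ipath E [x, y, z]" "E x (b i)" "E z (b j)" "labels [y] = {}" "set [x, y, z] \<subseteq> Out"
      using e R by (simp_all add: ear_def)
    have ex: "E x y" "E y z" "\<not> E x z" "x \<noteq> y" "y \<noteq> z" "x \<noteq> z" using ip(1) by auto
    have ex': "E y x" "E z y" "\<not> E z x" using ex sym by blast+
    have o: "x \<in> Out" "y \<in> Out" "z \<in> Out" using ip(5) by simp_all
    have lx: "E x (b l) \<longleftrightarrow> l = i" "E z (b l) \<longleftrightarrow> l = j" "\<not> E y (b l)" for l
      using one_label[OF o(1) ip(2)] ip(2) one_label[OF o(3) ip(3)] ip(3) ip(4) by (blast, blast, simp)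
    have ne: "x \<noteq> g l" "y \<noteq> g l" "z \<noteq> g l" for l using o by (auto simp: Out_def g_def)
    have sp_inj: "(spin ^^ k) l = i \<longleftrightarrow> l = C0" "(spin ^^ k) l = j \<longleftrightarrow> l = C4" for l
      using k inj_eq[OF spin_pow(1)[of k]] by metis+
    have gl: "E x (g l) \<longleftrightarrow> l = C0" "E z (g l) \<longleftrightarrow> l = C4" "\<not> E y (g l)" for l
      using lx sp_inj by (simp_all add: g_def)
    have gr: "E (g l) x \<longleftrightarrow> l = C0" "E (g l) z \<longleftrightarrow> l = C4" "\<not> E (g l) y" for l
      using gl sym by blast+
    \<comment> \<open>The theta graph: the two halves of the octagon and the ear are its three paths.\<close>
    define h where "h = (\<lambda>t. case t of TU \<Rightarrow> g C0 | A1 \<Rightarrow> g C1 | M1 \<Rightarrow> g C2 | B1 \<Rightarrow> g C3 | TW \<Rightarrow> g C4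
      | B2 \<Rightarrow> g C5 | M2 \<Rightarrow> g C6 | A2 \<Rightarrow> g C7 | A3 \<Rightarrow> x | M3 \<Rightarrow> y | B3 \<Rightarrow> z)"
    have h: "h TU = g C0" "h A1 = g C1" "h M1 = g C2" "h B1 = g C3" "h TW = g C4" "h B2 = g C5"
      "h M2 = g C6" "h A2 = g C7" "h A3 = x" "h M3 = y" "h B3 = z" by (simp_all add: h_def)
    have "h s = h t \<Longrightarrow> s = t" for s t
      by (cases s; cases t; simp only: h inj_eq[OF gi] ne ne[THEN not_sym] ex(4-6) ex(4-6)[THEN not_sym]
        oct.distinct simp_thms theta.distinct)
    moreover have "E (h s) (h t) \<longleftrightarrow> t \<in> set (theta_nb s)" for s t
      by (cases s; cases t; simp add: h gE gl gr ex ex' irr)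
    ultimately show False using no_theta[of h] by (auto simp: inj_def)
  qed
  interpret odd_base V E b oct_nb oct_col octs "[]"
  proof
    show "odd_type R i j" if "ear R i j {}" "i \<noteq> j" "\<not> adj i j" "\<not> among [] i j" for R i j
    proof (cases "capped_dist oct_nb j i = 4")
      case True
      then have "capped_dist oct_nb i j = 4" by (cases i; cases j) (auto simp: capped_dist_def)
      then show ?thesis using antipodal that by blast
    next
      case False
      moreover have "j = i \<or> adj j i \<or> capped_dist oct_nb j i = 4 \<or> two_ways oct_nb octs j i"
        using oct_ways usU by (metis UNIV_I)
      ultimately have "two_ways oct_nb octs j i"
        using that(2,3) adj_sym[of i j] by metis
      then show ?thesis using two_ways_odd that by blast
    qed
  qed (rule usU)
  have start: "\<exists>w\<in>Out. E w (b m)" if "length (oct_nb m) = 2" for m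
    using outer_neighbour[OF that deg] by blast
  have sp: "\<exists>v k. reach E Out w v \<and> E v (b k) \<and> k \<noteq> m \<and> k \<noteq> x" if "w \<in> Out" "x \<in> set (oct_nb m)" for w m x
  proof -
    have "\<exists>k. k \<noteq> m \<and> k \<noteq> x" by (metis oct.distinct(1,3,15))
    then show ?thesis using spread[OF conn that] by blast
  qed
  have len: "length (oct_nb m) = 2" for m by (cases m) auto
  have far: "\<not> ear R i j {}" if "(i, j) \<in> set (pairs oct_far)" for i j R
    by (rule refutes_sound[OF _ start sp oct_far _ that]) (auto simp: len)
  have mid: "\<not> ear R i j {}" if "(i, j) \<in> set (pairs oct_mid)" for i j R
    by (rule refutes_sound[OF far start sp oct_mid _ that]) (auto simp: len)
  show False
  proof (rule refuted_sound[OF _ _ sp _ oct_final])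
    show "\<not> ear R i j {}" if "(i, j) \<in> set (pairs oct_far @ pairs oct_mid)" for i j R
      using that far mid by auto
    show "\<exists>w\<in>Out. E w (b m)" for m by (rule start[OF len])
    show "\<exists>R. holds g R" if "g \<in> set []" for g using that by simp
  qed
qed

end

section \<open>Pair graphs\<close>

definition edge :: "'a pair_pre_digraph \<Rightarrow> 'a \<Rightarrow> 'a \<Rightarrow> bool" where
  "edge G x y \<longleftrightarrow> (x, y) \<in> parcs G"

text \<open>
  The arcs of the cycle that leaves z, runs along p and returns to z.
\<close>

definition cycle_arcs :: "'a \<Rightarrow> 'a list \<Rightarrow> ('a \<times> 'a) list" where
  "cycle_arcs z p = zip (z # p) (p @ [z])"

lemma zip_walk:
  "pcas u (zip (u # p) (p @ [w])) w" "pawalk_verts u (zip (u # p) (p @ [w])) = u # p @ [w]"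
  "set (zip (u # p) (p @ [w])) \<subseteq> {(x, y). F x y} \<longleftrightarrow> successively F (u # p @ [w])"
  by (induction p arbitrary: u) auto

lemma cycle_arcs_basic:
  "length (cycle_arcs z p) = length p + 1" "fst ` set (cycle_arcs z p) = set (z # p)"
proof -
  show "length (cycle_arcs z p) = length p + 1" by (simp add: cycle_arcs_def)
  have "map fst (cycle_arcs z p) = z # p" by (simp add: cycle_arcs_def del: zip_Cons_Cons)
  then show "fst ` set (cycle_arcs z p) = set (z # p)" by (metis list.set_map)
qed

lemma ipath_edge:
  "ipath E p \<Longrightarrow> x \<in> set p \<Longrightarrow> y \<in> set p \<Longrightarrow> E x y \<Longrightarrow> (\<And>a c. E a c \<Longrightarrow> E c a) \<Longrightarrow> (\<And>a. \<not> E a a) \<Longrightarrow>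
   (x, y) \<in> set (zip p (tl p)) \<or> (y, x) \<in> set (zip p (tl p))"
proof (induction p)
  case (Cons a p)
  show ?case
  proof (cases "x = a \<or> y = a")
    case True
    then obtain v where v: "v \<in> set p" "E a v" "{x, y} = {a, v}"
    proof
      assume "x = a"
      then show ?thesis using that[of y] Cons.prems(3-6) by auto
    next
      assume "y = a"
      then show ?thesis using that[of x] Cons.prems(2,4-6) by auto
    qed
    then have "v = hd p" using Cons.prems(1) by simp
    then have "(a, v) \<in> set (zip (a # p) (tl (a # p)))" using v(1) by (cases p) auto
    then show ?thesis using v(3) by (auto simp: doubleton_eq_iff)
  next
    case False
    then have "(x, y) \<in> set (zip p (tl p)) \<or> (y, x) \<in> set (zip p (tl p))" using Cons by auto
    then show ?thesis by (cases p) auto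
  qed
qed simp

context pair_graph begin

lemma edge_sym: "edge G x y \<Longrightarrow> edge G y x"
  using pair_sym_arcs by (auto simp: edge_def symmetric_def dest: symD)

lemma edge_irr: "\<not> edge G x x"
  using pair_no_loops by (force simp: edge_def)

lemma edge_verts: "edge G x y \<Longrightarrow> x \<in> pverts G"
  using in_arcsD1 by (auto simp: edge_def)

lemma undir_cycleI:
  assumes "distinct (z # p)" "2 \<le> length p" "successively (edge G) (z # p)" "edge G (last p) z"
  shows "undir_cycle G (cycle_arcs z p)"
proof -
  have "successively (edge G) (z # p @ [z])"
    using assms successively_append_iff[of "edge G" "z # p" "[z]"] by auto
  then have "set (cycle_arcs z p) \<subseteq> parcs G"
    using zip_walk(3)[of z p z "edge G"] by (auto simp: cycle_arcs_def edge_def)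
  moreover have "z \<in> pverts G" using assms(4) edge_sym edge_verts by blast
  ultimately show ?thesis
    using assms(1,2) zip_walk(1,2)[of z p z]
    unfolding undir_cycle_def cycle_def awalk_def by (auto simp: cycle_arcs_def simp del: zip_Cons_Cons)
qed

lemma induced_cycleI:
  assumes "ipath (edge G) p" "2 \<le> length p" "z \<notin> set p"
    "\<And>y. y \<in> set p \<Longrightarrow> edge G z y \<longleftrightarrow> y = hd p \<or> y = last p"
  shows "induced_cycle G (cycle_arcs z p)"
proof -
  have ne: "p \<noteq> []" using assms(2) by auto
  have hl: "edge G z (hd p)" "edge G (last p) z" using assms(4) ne edge_sym by auto
  then have uc: "undir_cycle G (cycle_arcs z p)"
    using assms ne ipath_distinct ipath_successively by (intro undir_cycleI) (auto simp: successively_Cons)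
  then have sub: "set (cycle_arcs z p) \<subseteq> parcs G" by (auto simp: undir_cycle_def cycle_def awalk_def)
  have zs: "cycle_arcs z p = (z, hd p) # zip p (tl p @ [z])" using ne by (cases p) (auto simp: cycle_arcs_def)
  have lz: "(last p, z) \<in> set (zip p (tl p @ [z]))" and tz: "set (zip p (tl p)) \<subseteq> set (zip p (tl p @ [z]))"
    using ne by (induction p rule: induct_list012) auto
  have "{e \<in> parcs G. fst e \<in> set (z # p) \<and> snd e \<in> set (z # p)} = set (cycle_arcs z p) \<union> (set (cycle_arcs z p))\<inverse>"
  proof (intro equalityI subsetI)
    fix e assume "e \<in> {e \<in> parcs G. fst e \<in> set (z # p) \<and> snd e \<in> set (z # p)}"
    then obtain x y where e: "e = (x, y)" "edge G x y" "x \<in> set (z # p)" "y \<in> set (z # p)"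
      by (cases e) (auto simp: edge_def)
    consider "x = z" "y \<in> set p" | "y = z" "x \<in> set p" | "x \<in> set p" "y \<in> set p"
      using e edge_irr by auto
    then show "e \<in> set (cycle_arcs z p) \<union> (set (cycle_arcs z p))\<inverse>"
    proof cases
      case 1
      then show ?thesis using e assms(4)[of y] lz unfolding zs by auto
    next
      case 2
      then show ?thesis using e assms(4)[of x] edge_sym[of x z] lz unfolding zs by auto
    next
      case 3
      then have "(x, y) \<in> set (zip p (tl p)) \<or> (y, x) \<in> set (zip p (tl p))"
        using ipath_edge[OF assms(1)] e(2) edge_sym edge_irr by blast
      then show ?thesis using tz e(1) unfolding zs by auto
    qed
  next
    fix e assume "e \<in> set (cycle_arcs z p) \<union> (set (cycle_arcs z p))\<inverse>"
    then obtain x y where xy: "(x, y) \<in> set (cycle_arcs z p)" "e = (x, y) \<or> e = (y, x)"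
      by (cases e) auto
    have "x \<in> set (z # p)" "y \<in> set (z # p)"
      using xy(1) set_zip_leftD[of x y "z # p" "p @ [z]"] set_zip_rightD[of x y "z # p" "p @ [z]"]
      by (auto simp: cycle_arcs_def simp del: zip_Cons_Cons)
    moreover have "edge G x y" using xy(1) sub by (auto simp: edge_def)
    ultimately show "e \<in> {e \<in> parcs G. fst e \<in> set (z # p) \<and> snd e \<in> set (z # p)}"
      using xy(2) edge_sym[of x y] by (auto simp: edge_def)
  qed
  then show ?thesis using uc cycle_arcs_basic(2)[of z p]
    by (simp add: induced_cycle_def induce_subgraph_def)
qed

lemma connected_reach:
  assumes "Digraph_Component.connected (with_proj G \<restriction> S)" "u \<in> S" "w \<in> S"
  shows "reach (edge G) S u w"
proof -
  have "u \<rightarrow>\<^sup>*\<^bsub>with_proj (mk_symmetric (with_proj G \<restriction> S))\<^esub> w"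
    using assms by (auto simp: connected_def strongly_connected_def mk_symmetric_def)
  then have "(u, w) \<in> rtrancl_on S (parcs (mk_symmetric (with_proj G \<restriction> S)))"
    by (simp add: reachable_def mk_symmetric_def)
  then show ?thesis
  proof (induction rule: rtrancl_on_induct)
    case base
    then show ?case by (simp add: reach_def)
  next
    case (step y z)
    then have "edge G y z" using edge_sym by (auto simp: mk_symmetric_def induce_subgraph_def edge_def)
    then show ?case using reach_step step by metis
  qed
qed

lemma clique_cut_reach:
  assumes "\<not> clique_cut k G X" "X \<subseteq> pverts G" "card X = k" "\<And>x y. x \<in> X \<Longrightarrow> y \<in> X \<Longrightarrow> x \<noteq> y \<Longrightarrow> edge G x y"
    "u \<in> pverts G - X" "w \<in> pverts G - X"
  shows "reach (edge G) (pverts G - X) u w"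
proof -
  have sub: "induced_subgraph (with_proj G \<restriction> X) (with_proj G)" using assms(2) by (simp add: induced_induce)
  interpret D: digraph "with_proj G \<restriction> X" using sub by (rule digraphI_induced)
  interpret S: sym_digraph "with_proj G \<restriction> X" using sub by (rule induced_graph_imp_graph)
  have "Digraph.graph (with_proj G \<restriction> X)" by unfold_locales
  then have "complete_digraph k (with_proj G \<restriction> X)"
    using assms(3,4) edge_irr unfolding complete_digraph_def
    by (auto simp: arcs_ends_conv induce_subgraph_def edge_def)
  then have "Digraph_Component.connected (with_proj G \<restriction> (pverts G - X))"
    using assms(1,2) by (auto simp: clique_cut_def)
  then show ?thesis using connected_reach assms(5,6) by blast
qed


lemma pawalk_vertices:
  "pcas u p w \<Longrightarrow> set p \<subseteq> parcs G \<Longrightarrow> successively (edge G) (pawalk_verts u p) \<and>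
    hd (pawalk_verts u p) = u \<and> last (pawalk_verts u p) = w \<and> length (pawalk_verts u p) = length p + 1"
proof (induction p arbitrary: u)
  case (Cons e p)
  then have "successively (edge G) (pawalk_verts (snd e) p)" "hd (pawalk_verts (snd e) p) = snd e"
    "last (pawalk_verts (snd e) p) = w" "length (pawalk_verts (snd e) p) = length p + 1"
    "edge G (fst e) (snd e)" "fst e = u" by (auto simp: edge_def)
  then show ?case by (cases "pawalk_verts (snd e) p") auto
qed simp

lemma undir_cycleE:
  assumes "undir_cycle G p"
  obtains z q where "length p = length q + 1" "distinct (z # q)" "successively (edge G) (z # q)" "edge G (last q) z"
proof -
  obtain u where u: "set p \<subseteq> parcs G" "pcas u p u" "distinct (tl (pawalk_verts u p))" "3 \<le> length p"
    using assms by (auto simp: undir_cycle_def cycle_def awalk_def)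
  let ?vs = "pawalk_verts u p"
  have vs: "successively (edge G) ?vs" "hd ?vs = u" "last ?vs = u" "length ?vs = length p + 1"
    using pawalk_vertices[OF u(2,1)] by auto
  then obtain r where r: "?vs = u # r" "length r = length p" by (cases ?vs) auto
  have "r \<noteq> []" using r(2) u(4) by auto
  then have "r = butlast r @ [u]" using vs(3) r(1) append_butlast_last_id[of r] by simp
  then obtain q where q: "r = q @ [u]" by blast
  have "q \<noteq> []" using q r(2) u(4) by auto
  have "successively (edge G) ((u # q) @ [u])" using vs(1) r(1) q by simp
  then have "successively (edge G) (u # q)" "edge G (last q) u"
    using \<open>q \<noteq> []\<close> successively_append_iff[of "edge G" "u # q" "[u]"] by auto
  then show ?thesis using that[of q u] q r u(3) by auto
qed

end

lemma reach_dead_end: "reach E S v w \<Longrightarrow> (\<And>u. E v u \<Longrightarrow> u \<notin> S) \<Longrightarrow> w = v"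
  unfolding reach_def by (erule converse_rtranclpE) auto

fun oct_index :: "oct \<Rightarrow> nat" where
  "oct_index C0 = 0" | "oct_index C1 = 1" | "oct_index C2 = 2" | "oct_index C3 = 3"
| "oct_index C4 = 4" | "oct_index C5 = 5" | "oct_index C6 = 6" | "oct_index C7 = 7"

text \<open>
  A chord of an 8-cycle would cut off a shorter cycle, so an 8-cycle is an induced subgraph.
\<close>

lemma (in girth8) octagon:
  assumes "distinct (z # q)" "length q = 7" "successively E (z # q)" "E (last q) z"
  shows "\<exists>b :: oct \<Rightarrow> 'a. inj b \<and> (\<forall>i j. E (b i) (b j) \<longleftrightarrow> j \<in> set (oct_nb i))"
proof -
  define c where "c = z # q"
  have c: "length c = 8" "distinct c" using assms by (auto simp: c_def)
  have step: "E (c ! k) (c ! Suc k)" if "k < 7" for k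
    using assms(2,3) that by (auto simp: successively_conv_nth c_def)
  have "last q = q ! 6" using assms(2) by (subst last_conv_nth) auto
  then have close: "E (c ! 7) (c ! 0)" using assms(4) by (simp add: c_def)
  have chord: "j = i + 1 \<or> (i = 0 \<and> j = 7)" if "i < j" "j < 8" "E (c ! i) (c ! j)" for i j
  proof (rule ccontr)
    assume n: "\<not> ?thesis"
    define xs where "xs = drop i (take (j + 1) c)"
    have l: "length xs = j + 1 - i" and nth: "\<And>k. k < j + 1 - i \<Longrightarrow> xs ! k = c ! (i + k)"
      using that c by (auto simp: xs_def)
    obtain x p where xs: "xs = x # p" using l \<open>i < j\<close> by (cases xs) auto
    have x: "x = c ! i" using nth[of 0] that xs by simp
    have "7 \<le> length p"
    proof (rule girth)
      show "distinct (x # p)" using c(2) by (simp add: xs[symmetric] xs_def)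
      have "j \<noteq> i + 1" using n by simp
      moreover have len: "length p = j - i" using l xs that(1) by simp
      ultimately show "2 \<le> length p" using that(1) by linarith
      have "last p = xs ! (j - i)" using len xs that(1) by (cases "p = []") (auto simp: last_conv_nth nth_Cons')
      then show "E (last p) x" using nth[of "j - i"] that sym x by simp
      have "successively E xs" using l nth step that(2) by (auto simp: successively_conv_nth)
      then show "successively E (x # p)" by (simp add: xs)
    qed
    then have "7 \<le> j - i" using l xs that(1) by simp
    then have "i = 0 \<and> j = 7" using that(2) by linarith
    then show False using n by simp
  qed
  have E: "E (c ! i) (c ! j) \<longleftrightarrow> j = i + 1 \<or> i = j + 1 \<or> (i = 0 \<and> j = 7) \<or> (i = 7 \<and> j = 0)"
    if "i < 8" "j < 8" for i j
  proof
    assume "E (c ! i) (c ! j)"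
    then show "j = i + 1 \<or> i = j + 1 \<or> (i = 0 \<and> j = 7) \<or> (i = 7 \<and> j = 0)"
      using chord[of i j] chord[of j i] sym irr that by (cases i j rule: linorder_cases) auto
  next
    assume "j = i + 1 \<or> i = j + 1 \<or> (i = 0 \<and> j = 7) \<or> (i = 7 \<and> j = 0)"
    then show "E (c ! i) (c ! j)" using step[of i] step[of j] close sym that by auto
  qed
  have i8: "oct_index l < 8" for l by (cases l) auto
  have "l = k" if "oct_index l = oct_index k" for l k using that by (cases l; cases k) auto
  then have "inj (\<lambda>l. c ! oct_index l)" using c i8 by (auto simp: inj_def nth_eq_iff_index_eq)
  moreover have "E (c ! oct_index i) (c ! oct_index j) \<longleftrightarrow> j \<in> set (oct_nb i)" for i j
    unfolding E[OF i8 i8] by (cases i; cases j) auto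
  ultimately show ?thesis by blast
qed

theorem theorem1p4:
  fixes G :: "'a pair_pre_digraph"
  assumes "G \<in> H_family 4"
  shows "(\<exists>v. degree2_vertex G v) \<or> (\<exists>X. clique_cut 1 G X) \<or> (\<exists>X. clique_cut 2 G X)"
proof (rule ccontr)
  assume none: "\<not> ?thesis"
  have G: "pair_graph G" "girth G = enat 8" "\<And>p. even_hole G p \<Longrightarrow> length p < 10"
    using assms by (auto simp: H_family_def not_le)
  interpret pair_graph G by fact
  have eight: "8 \<le> length p" if "undir_cycle G p" for p
  proof -
    have "girth G \<le> enat (length p)" unfolding girth_def using that by (intro INF_lower) simp
    then show ?thesis using G(2) by simp
  qed
  interpret girth8 "pverts G" "edge G"
  proof
    show "edge G y x" if "edge G x y" for x y using that by (rule edge_sym)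
    show "\<not> edge G x x" for x by (rule edge_irr)
    show "x \<in> pverts G" if "edge G x y" for x y using that by (rule edge_verts)
    show "7 \<le> length p"
      if "distinct (z # p)" "2 \<le> length p" "successively (edge G) (z # p)" "edge G (last p) z" for z p
      using eight[OF undir_cycleI[OF that]] cycle_arcs_basic(1)[of z p] by simp
    show "length p \<le> 7" if "ipath (edge G) p" "2 \<le> length p" "z \<notin> set p"
      "\<And>y. y \<in> set p \<Longrightarrow> edge G z y \<longleftrightarrow> y = hd p \<or> y = last p" "odd (length p)" for p z
    proof -
      have c: "induced_cycle G (cycle_arcs z p)" using that(1-4) by (rule induced_cycleI)
      then have "8 \<le> length p + 1" using eight[of "cycle_arcs z p"] cycle_arcs_basic(1)[of z p]
        by (simp only: induced_cycle_def)
      then have "even_hole G (cycle_arcs z p)"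
        using c cycle_arcs_basic(1)[of z p] that(5) by (simp add: even_hole_def hole_def)
      then have "length p + 1 < 10" using G(3) cycle_arcs_basic(1)[of z p] by metis
      then show ?thesis using that(5) by presburger
    qed
  qed
  obtain p where "undir_cycle G p" "length p = 8"
  proof -
    let ?L = "(\<lambda>p. enat (length p)) ` {p. undir_cycle G p}"
    have I: "Inf ?L = enat 8" using G(2) by (simp add: girth_def)
    have "?L \<noteq> {}"
    proof
      assume "?L = {}"
      then show False using I by (simp only: Inf_enat_def) simp
    qed
    then obtain n where "n \<in> ?L" by blast
    then have "(LEAST n. n \<in> ?L) \<in> ?L" by (rule LeastI)
    then have "Inf ?L \<in> ?L" using \<open>?L \<noteq> {}\<close> by (simp only: Inf_enat_def if_False)
    then show ?thesis using that I by auto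
  qed
  then obtain z q where q: "distinct (z # q)" "length q = 7" "successively (edge G) (z # q)" "edge G (last q) z"
    by (elim undir_cycleE) simp
  obtain b :: "oct \<Rightarrow> 'a" where b: "inj b" "\<And>i j. edge G (b i) (b j) \<longleftrightarrow> j \<in> set (oct_nb i)"
    using octagon[OF q] by blast
  have third: "\<exists>w\<in>pverts G. w \<noteq> x \<and> w \<noteq> y" for x y
  proof -
    have "oct_nb i \<noteq> []" for i by (cases i) auto
    then have "b i \<in> pverts G" for i using b(2)[of i "hd (oct_nb i)"] EV by simp
    moreover have "b C0 \<noteq> b C1" "b C0 \<noteq> b C2" "b C1 \<noteq> b C2" using b(1) by (auto simp: inj_eq)
    ultimately show ?thesis by metis
  qed
  interpret uncut "pverts G" "edge G"
  proof
    show "reach (edge G) (pverts G - {x, y}) u w"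
      if "edge G x y" "u \<in> pverts G - {x, y}" "w \<in> pverts G - {x, y}" for x y u w
    proof (rule clique_cut_reach[of 2])
      show "\<not> clique_cut 2 G {x, y}" using none by blast
      show "{x, y} \<subseteq> pverts G" using that(1) EV sym by blast
      show "card {x, y} = 2" using that(1) irr by (auto simp: card_insert_if)
      show "edge G s t" if "s \<in> {x, y}" "t \<in> {x, y}" "s \<noteq> t" for s t
        using that \<open>edge G x y\<close> sym by blast
    qed (use that in auto)
    show "\<exists>w. edge G v w \<and> w \<noteq> x \<and> w \<noteq> y" if v: "v \<in> pverts G" for v x y
    proof (rule ccontr)
      assume n: "\<not> ?thesis"
      let ?N = "{w. edge G v w}"
      have sub: "?N \<subseteq> {x, y}" using n by blast
      have "card ?N \<noteq> 2"
      proof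
        assume "card ?N = 2"
        then have "degree2_vertex G v" using v by (simp add: degree2_vertex_def edge_def)
        then show False using none by blast
      qed
      then have "?N \<noteq> {x, y} \<or> x = y" by fastforce
      then obtain t where t: "?N \<subseteq> {t}" using sub by blast
      \<comment> \<open>If v has at most one neighbour, deleting it, or any vertex besides v if there is none, isolates v.\<close>
      obtain s where s: "s \<in> pverts G" "s \<noteq> v" "?N \<subseteq> {s}"
      proof (cases "?N = {}")
        case True
        then show ?thesis using third[of v v] that by blast
      next
        case False
        then have "edge G v t" using t by blast
        then show ?thesis using that[of t] t irr sym EV by blast
      qed
      obtain w where w: "w \<in> pverts G" "w \<noteq> v" "w \<noteq> s" using third[of v s] by blast
      have "reach (edge G) (pverts G - {s}) v w"
      proof (rule clique_cut_reach[of 1])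
        show "\<not> clique_cut 1 G {s}" using none by blast
      qed (use s v w in auto)
      then have "w = v" by (rule reach_dead_end) (use s(3) in blast)
      then show False using w(2) by simp
    qed
  qed
  show False using no_octagon b by blast
qed

end
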